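(* There is an algorithm for indexing necklaces of length $n$ over the alphabet $\{0,1\}$ which runs in time $\mathsf{poly}(n)$: on input $n$ and $j$, it outputs a string of the $j$-th necklace under some fixed bijection between $\{1,\ldots,N\}$ and the set of binary necklaces of length $n$ ($N$ their number), and outputs "too large" if $j>N$.
   Context: A necklace of length $n$ over an alphabet $\Sigma$ is an equivalence class of strings in $\Sigma^n$ under cyclic rotation: $x\sim y$ iff $x=x^1x^2$ and $y=x^2x^1$ for some strings $x^1,x^2$. *)

theory Defs
  imports Main
begin

definition bin_strings :: "nat \<Rightarrow> bool list set" where
  "bin_strings n = {x. length x = n}"

definition necklace_rel :: "nat \<Rightarrow> (bool list \<times> bool list) set" where
  "necklace_rel n = {(x, y). length x = n \<and> length y = n \<and>
      (\<exists>x1 x2. x = x1 @ x2 \<and> y = x2 @ x1)}"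

definition necklaces :: "nat \<Rightarrow> bool list set set" where
  "necklaces n = bin_strings n // necklace_rel n"

datatype aexp = Num nat | Var nat | Plus aexp aexp | Minus aexp aexp
  | Mult aexp aexp | Div aexp aexp | Mod aexp aexp

datatype bexp = Bc bool | Not bexp | And bexp bexp | Less aexp aexp | Eq aexp aexp

datatype com = SKIP | Assign nat aexp | Seq com com | If bexp com com | While bexp com

type_synonym state = "nat \<Rightarrow> nat"

definition bitlen :: "nat \<Rightarrow> nat" where
  "bitlen x = Suc (LEAST k. x < 2 ^ k)"

fun aval :: "aexp \<Rightarrow> state \<Rightarrow> nat" where
  "aval (Num c) s = c"
| "aval (Var x) s = s x"
| "aval (Plus a b) s = aval a s + aval b s"
| "aval (Minus a b) s = aval a s - aval b s"
| "aval (Mult a b) s = aval a s * aval b s"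
| "aval (Div a b) s = aval a s div aval b s"
| "aval (Mod a b) s = aval a s mod aval b s"

fun acost :: "aexp \<Rightarrow> state \<Rightarrow> nat" where
  "acost (Num c) s = bitlen c"
| "acost (Var x) s = bitlen (s x)"
| "acost (Plus a b) s = acost a s + acost b s + 1"
| "acost (Minus a b) s = acost a s + acost b s + 1"
| "acost (Mult a b) s = acost a s + acost b s + 1"
| "acost (Div a b) s = acost a s + acost b s + 1"
| "acost (Mod a b) s = acost a s + acost b s + 1"

fun bval :: "bexp \<Rightarrow> state \<Rightarrow> bool" where
  "bval (Bc v) s = v"
| "bval (Not b) s = (\<not> bval b s)"
| "bval (And b1 b2) s = (bval b1 s \<and> bval b2 s)"
| "bval (Less a b) s = (aval a s < aval b s)"
| "bval (Eq a b) s = (aval a s = aval b s)"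

fun bcost :: "bexp \<Rightarrow> state \<Rightarrow> nat" where
  "bcost (Bc v) s = 1"
| "bcost (Not b) s = bcost b s + 1"
| "bcost (And b1 b2) s = bcost b1 s + bcost b2 s + 1"
| "bcost (Less a b) s = acost a s + acost b s + 1"
| "bcost (Eq a b) s = acost a s + acost b s + 1"

inductive big_step :: "com \<Rightarrow> state \<Rightarrow> nat \<Rightarrow> state \<Rightarrow> bool" where
  Skip: "big_step SKIP s 1 s"
| Assign: "big_step (Assign x a) s (acost a s + 1) (s(x := aval a s))"
| Seq: "big_step c1 s1 t1 s2 \<Longrightarrow> big_step c2 s2 t2 s3 \<Longrightarrow> big_step (Seq c1 c2) s1 (t1 + t2 + 1) s3"
| IfT: "bval b s \<Longrightarrow> big_step c1 s t s' \<Longrightarrow> big_step (If b c1 c2) s (bcost b s + t + 1) s'"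
| IfF: "\<not> bval b s \<Longrightarrow> big_step c2 s t s' \<Longrightarrow> big_step (If b c1 c2) s (bcost b s + t + 1) s'"
| WhileF: "\<not> bval b s \<Longrightarrow> big_step (While b c) s (bcost b s + 1) s"
| WhileT: "bval b s1 \<Longrightarrow> big_step c s1 t1 s2 \<Longrightarrow> big_step (While b c) s2 t2 s3 \<Longrightarrow>
    big_step (While b c) s1 (bcost b s1 + t1 + t2 + 1) s3"

text \<open>Input/output conventions: register 0 holds n, register 1 holds j, all others 0.
  On termination register 2 is the flag (1 = "too large", 0 = a string is output)
  and register 3 encodes the output string of length n in binary
  (bit i of the number = i-th character).\<close>

definition init_state :: "nat \<Rightarrow> nat \<Rightarrow> state" where
  "init_state n j = (\<lambda>r. if r = 0 then n else if r = 1 then j else 0)"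

definition decode_string :: "nat \<Rightarrow> nat \<Rightarrow> bool list" where
  "decode_string n code = map (\<lambda>i. odd (code div 2 ^ i)) [0..<n]"

end

theory Submission
  imports Defs
begin

text \<open>
  Necklaces are ordered by their smallest rotation, in decreasing order, and the smallest rotation of
  the \<open>j\<close>-th one is built bit by bit: the next bit is 0 iff fewer than \<open>j\<close> necklaces have all rotations
  larger than \<open>w 0\<close>, where \<open>w\<close> is the prefix found so far. By Burnside's lemma this number is
  \<open>1/n\<close> times the sum over \<open>q = 1, \<dots>, n\<close> of the number of words of period \<open>gcd n q\<close> all of whose factors
  exceed \<open>w 0\<close>. If \<open>w 0\<close> is a prenecklace, these periodic words are exactly the cyclic
  concatenations of the tiles \<open>v 1\<close>, where \<open>v 0\<close> is a prefix of \<open>w 0\<close>, and the decomposition into tiles is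
  unique; the count is then a coefficient of a rational generating function, which a single integer
  division reads off after evaluation at a large power of two. Whether \<open>w 0\<close> is a prenecklace is decided,
  as in Duval's algorithm, by comparing the new bit with the one a minimal period earlier.
\<close>

section \<open>Tilings of periodic words\<close>

text \<open>The order is decreasing because "every rotation exceeds \<open>w 0\<close>" is closed
  under rotation and can be checked position by position, which is what Burnside's lemma and the
  tilings count. Uniqueness of the tiles rests on nesting: for a prenecklace, a block that starts
  inside another block never outlasts it, so block intervals overlap only by inclusion and the
  outermost ones are the tiles. The machine has number registers and no arrays, so the table of
  tiling counts is packed into one number. With \<open>X = 64 ^ n\<close> no carry occurs between
  base-\<open>X\<close> digits: the coefficients involved sum to at most \<open>32 ^ n\<close>. Time
  is measured against \<open>n\<close> itself, not its length, so \<open>n\<close> rounds and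
  Euclid's algorithm by subtraction are affordable. Whether \<open>j\<close> is too large is known
  only at the end. As long as all bits are 0 no upper bound on \<open>j\<close> is claimed, and the
  last count then gives the number of necklaces. That every admissible \<open>j\<close> is attained
  is not shown separately: the terminating run itself produces the word, and the bijection is built
  from these words.\<close>

definition block :: "(nat \<Rightarrow> bool) \<Rightarrow> nat \<Rightarrow> (int \<Rightarrow> bool) \<Rightarrow> int \<Rightarrow> nat \<Rightarrow> bool" where
  "block w L f t i \<longleftrightarrow> i < L \<and> \<not> w i \<and> (\<forall>s<i. f (t + int s) = w s) \<and> f (t + int i)"

text \<open>Positions range over the integers, so that shifts by negative multiples of a period,
  which Bezout's identity calls for, are available.\<close>

definition above :: "(nat \<Rightarrow> bool) \<Rightarrow> nat \<Rightarrow> (int \<Rightarrow> bool) \<Rightarrow> bool" where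
  "above w L f \<longleftrightarrow> (\<forall>t. \<exists>i. block w L f t i)"

text \<open>The usual notion: no factor of \<open>w\<close> is smaller than the prefix of equal
  length. Only a 0 at \<open>i\<close> standing against a 1 at \<open>i - s\<close> could make the
  factor at \<open>s\<close> smaller, so only indices with \<open>w i\<close> false are
  constrained.\<close>

definition prenecklace :: "(nat \<Rightarrow> bool) \<Rightarrow> nat \<Rightarrow> bool" where
  "prenecklace w L \<longleftrightarrow>
    (\<forall>i<L. \<forall>s. \<not> w i \<and> 0 < s \<and> s \<le> i \<and> (\<forall>u<i - s. w (s + u) = w u) \<longrightarrow> \<not> w (i - s))"

definition periodic :: "nat \<Rightarrow> (int \<Rightarrow> bool) \<Rightarrow> bool" where
  "periodic m f \<longleftrightarrow> (\<forall>t. f (t + int m) = f t)"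

definition zeros :: "(nat \<Rightarrow> bool) \<Rightarrow> nat \<Rightarrow> nat set" where
  "zeros w L = {i. i < L \<and> \<not> w i}"

definition blk :: "(nat \<Rightarrow> bool) \<Rightarrow> nat \<Rightarrow> bool list" where
  "blk w i = map w [0..<i] @ [True]"

inductive_set tilings :: "(nat \<Rightarrow> bool) \<Rightarrow> nat \<Rightarrow> bool list set" for w L where
  Nil: "[] \<in> tilings w L"
| Cons: "i \<in> zeros w L \<Longrightarrow> y \<in> tilings w L \<Longrightarrow> blk w i @ y \<in> tilings w L"

definition tcount :: "(nat \<Rightarrow> bool) \<Rightarrow> nat \<Rightarrow> nat \<Rightarrow> nat" where
  "tcount w L m = card {y \<in> tilings w L. length y = m}"

lemma finite_zeros [simp]: "finite (zeros w L)"
  by (simp add: zeros_def)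

lemma length_blk [simp]: "length (blk w i) = Suc i"
  by (simp add: blk_def)

lemma nth_blk: "s \<le> i \<Longrightarrow> blk w i ! s = (if s = i then True else w s)"
  by (auto simp: blk_def nth_append)

lemma finite_bool_lists: "finite {y :: bool list. length y = m}"
  using finite_lists_length_eq[of "UNIV :: bool set" m] by simp

lemma card_bool_lists: "card {y :: bool list. length y = m} = 2 ^ m"
  using card_lists_length_eq[of "UNIV :: bool set" m] by simp

lemma tcount_le: "tcount w L m \<le> 2 ^ m"
  unfolding tcount_def card_bool_lists[of m, symmetric]
  by (rule card_mono[OF finite_bool_lists]) auto

lemma tcount_0 [simp]: "tcount w L 0 = 1"
proof -
  have "{y \<in> tilings w L. length y = 0} = {[]}"
    by (auto intro: tilings.Nil)
  then show ?thesis by (simp add: tcount_def)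
qed

text \<open>The tiles form a prefix code: at index \<open>a\<close> the tile for \<open>a\<close>
  ends with 1, while every longer tile still copies \<open>w a\<close>, which is 0.\<close>

lemma blk_append_inject:
  assumes "i \<in> zeros w L" "i' \<in> zeros w L" "blk w i @ y = blk w i' @ y'"
  shows "i = i'" "y = y'"
proof -
  have *: False if "a < b" "a \<in> zeros w L" "blk w a @ u = blk w b @ v" for a b u v
  proof -
    have "(blk w a @ u) ! a" using that(1,2) by (simp add: nth_append nth_blk)
    moreover have "\<not> (blk w b @ v) ! a" using that(1,2) by (simp add: nth_append nth_blk zeros_def)
    ultimately show False using that(3) by simp
  qed
  show "i = i'" using *[of i i'] *[of i' i] assms by (metis linorder_neqE_nat)
  then show "y = y'" using assms by simp
qed

lemma tcount_rec:
  assumes "0 < m"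
  shows "tcount w L m = (\<Sum>i\<in>{i\<in>zeros w L. i < m}. tcount w L (m - 1 - i))"
proof -
  let ?I = "{i\<in>zeros w L. i < m}"
  let ?S = "\<lambda>k. {y \<in> tilings w L. length y = k}"
  have eq: "?S m = (\<Union>i\<in>?I. (\<lambda>y. blk w i @ y) ` ?S (m - 1 - i))"
  proof (intro set_eqI iffI)
    fix y assume y: "y \<in> ?S m"
    then have "y \<in> tilings w L" by simp
    then show "y \<in> (\<Union>i\<in>?I. (\<lambda>y. blk w i @ y) ` ?S (m - 1 - i))"
    proof cases
      case Nil then show ?thesis using y assms by simp
    next
      case (Cons i z)
      then show ?thesis using y by (intro UN_I[of i]) auto
    qed
  next
    fix y assume "y \<in> (\<Union>i\<in>?I. (\<lambda>y. blk w i @ y) ` ?S (m - 1 - i))"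
    then show "y \<in> ?S m" by (auto intro: tilings.Cons)
  qed
  have fin: "finite (?S k)" for k
    by (rule finite_subset[OF _ finite_bool_lists[of k]]) auto
  have "card (?S m) = (\<Sum>i\<in>?I. card ((\<lambda>y. blk w i @ y) ` ?S (m - 1 - i)))"
    unfolding eq
  proof (rule card_UN_disjoint)
    show "\<forall>i\<in>?I. \<forall>j\<in>?I. i \<noteq> j \<longrightarrow>
        (\<lambda>y. blk w i @ y) ` ?S (m - 1 - i) \<inter> (\<lambda>y. blk w j @ y) ` ?S (m - 1 - j) = {}"
      using blk_append_inject(1) by blast
  qed (use fin in auto)
  also have "\<dots> = (\<Sum>i\<in>?I. card (?S (m - 1 - i)))"
    by (intro sum.cong refl card_image) (auto simp: inj_on_def)
  finally show ?thesis by (simp add: tcount_def)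
qed

lemma block_unique:
  assumes "block w L f t i" "block w L f t i'" shows "i = i'"
proof -
  have "\<not> a < b" if "block w L f t a" "block w L f t b" for a b
    using that unfolding block_def by blast
  then show ?thesis using assms by (meson linorder_neqE_nat)
qed

text \<open>Compare \<open>f\<close> from \<open>t + s\<close> on with \<open>w\<close>. Agreement
  up to the end of the block would force \<open>w (i - s)\<close> to be 1 while \<open>w i\<close>
  is 0, against the prenecklace property. At the first difference \<open>r\<close> the word
  \<open>w\<close> has a 0: at the end of the block because \<open>f\<close> has a 1 there, earlier
  because a 1 in \<open>w\<close> would again violate that property.\<close>

lemma block_nested:
  assumes pre: "prenecklace w L" and b: "block w L f t i" and s: "s \<le> i"
  shows "\<exists>r\<le>i - s. block w L f (t + int s) r"
proof (cases "s = 0")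
  case True then show ?thesis using b by auto
next
  case False
  have f: "f (t + int s + int u) = w (s + u)" if "u < i - s" for u
  proof -
    have "f (t + int (s + u)) = w (s + u)"
      using b that unfolding block_def by (metis add.commute less_diff_conv)
    then show ?thesis by (simp add: add.assoc)
  qed
  have fi: "f (t + int s + int (i - s))" using b s by (simp add: block_def)
  have "\<exists>r. r \<le> i - s \<and> f (t + int s + int r) \<noteq> w r"
  proof (rule ccontr)
    assume "\<not> ?thesis"
    then have eq: "\<And>r. r \<le> i - s \<Longrightarrow> f (t + int s + int r) = w r" by blast
    then have "\<forall>u<i - s. w (s + u) = w u" using f by auto
    then have "\<not> w (i - s)" using pre b s False unfolding prenecklace_def block_def by blast
    then show False using eq[of "i - s"] fi by simp
  qed
  then obtain r where r: "r \<le> i - s" "f (t + int s + int r) \<noteq> w r"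
    and least: "\<And>u. u < r \<Longrightarrow> f (t + int s + int u) = w u"
  proof -
    obtain r where r: "r \<le> i - s \<and> f (t + int s + int r) \<noteq> w r"
      and min: "\<And>u. u < r \<Longrightarrow> \<not> (u \<le> i - s \<and> f (t + int s + int u) \<noteq> w u)"
      using \<open>\<exists>r. _\<close> unfolding exists_least_iff[of "\<lambda>r. r \<le> i - s \<and> f (t + int s + int r) \<noteq> w r"]
      by blast
    have "f (t + int s + int u) = w u" if "u < r" for u
      using min[OF that] that r by auto
    then show thesis using that r by blast
  qed
  have "\<not> w r"
  proof (cases "r = i - s")
    case True then show ?thesis using r fi by simp
  next
    case F: False
    then have lt: "r < i - s" using r by simp
    show ?thesis
    proof
      assume "w r"
      then have "\<not> w (s + r)" using f[OF lt] r by simp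
      moreover have "\<forall>u<s + r - s. w (s + u) = w u" using f least lt by auto
      moreover have "s + r < L" using lt b by (auto simp: block_def)
      ultimately have "\<not> w (s + r - s)"
        using pre[unfolded prenecklace_def, rule_format, of "s + r" s] False by simp
      then show False using \<open>w r\<close> by simp
    qed
  qed
  moreover have "r < L" using r b s by (auto simp: block_def)
  ultimately have "block w L f (t + int s) r" using r(2) least by (simp add: block_def)
  then show ?thesis using r(1) by blast
qed

lemma tiling_cover:
  assumes "z \<in> tilings w L" "u < length z"
  shows "\<exists>b i. i \<in> zeros w L \<and> b \<le> u \<and> u \<le> b + i \<and> b + i < length z \<and> (\<forall>s\<le>i. z ! (b + s) = blk w i ! s)"
  using assms
proof (induction arbitrary: u rule: tilings.induct)
  case Nil then show ?case by simp
next
  case (Cons i y)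
  show ?case
  proof (cases "u \<le> i")
    case True
    then show ?thesis using Cons by (intro exI[of _ 0] exI[of _ i]) (auto simp: nth_append)
  next
    case False
    then have "u - Suc i < length y" using Cons by auto
    from Cons.IH[OF this] obtain b k where bk: "k \<in> zeros w L" "b \<le> u - Suc i" "u - Suc i \<le> b + k"
      "b + k < length y" "\<forall>s\<le>k. y ! (b + s) = blk w k ! s" by blast
    then show ?thesis using False by (intro exI[of _ "b + Suc i"] exI[of _ k]) (auto simp: nth_append)
  qed
qed

section \<open>Periodic words on the integers and their tile boundaries\<close>

lemma periodic_mult: "periodic m f \<Longrightarrow> f (t + int m * k) = f t"
proof (induction k rule: int_induct[of _ 0])
  case base then show ?case by simp
next
  case (step1 i)
  have "f (t + int m * i + int m) = f (t + int m * i)"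
    using step1.prems by (simp add: periodic_def)
  then show ?case using step1 by (simp add: algebra_simps)
next
  case (step2 i)
  have "f (t + int m * (i - 1)) = f (t + int m * (i - 1) + int m)"
    using step2.prems by (simp add: periodic_def)
  then show ?case using step2 by (simp add: algebra_simps)
qed

lemma periodic_mod: "periodic m f \<Longrightarrow> f (t + (u mod int m)) = f (t + u)"
  using periodic_mult[of m f "t + u mod int m" "u div int m"] by (simp add: add.assoc)

text \<open>A copy of \<open>z\<close> begins at position \<open>- int a\<close>, so position 0 sees
  offset \<open>a\<close> of \<open>z\<close>.\<close>

definition cyc :: "nat \<Rightarrow> bool list \<Rightarrow> int \<Rightarrow> bool" where
  "cyc a z t = z ! nat ((t + int a) mod int (length z))"

lemma periodic_cyc: "periodic (length z) (cyc a z)"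
proof -
  have "(t + int (length z) + int a) mod int (length z) = (t + int a) mod int (length z)" for t
    by (metis add.assoc add.commute mod_add_self2)
  then show ?thesis by (simp add: periodic_def cyc_def)
qed

text \<open>The last conjunct says that tiles left of \<open>- int a\<close> do not cross it; it is
  what later makes \<open>- int a\<close> a cut.\<close>

lemma cyc_cover:
  assumes z: "z \<in> tilings w L" "z \<noteq> []"
  shows "\<exists>b i. block w L (cyc a z) b i \<and> b \<le> t \<and> t \<le> b + int i \<and> (t < - int a \<longrightarrow> b + int i < - int a)"
proof -
  let ?m = "int (length z)"
  define u where "u = (t + int a) mod ?m"
  have m: "?m > 0" using z by simp
  have u: "0 \<le> u" "u < ?m" using m by (auto simp: u_def)
  then obtain b i where bi: "i \<in> zeros w L" "b \<le> nat u" "nat u \<le> b + i" "b + i < length z"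
    "\<forall>s\<le>i. z ! (b + s) = blk w i ! s"
    using tiling_cover[OF z(1), of "nat u"] by (metis nat_less_iff)
  \<comment> \<open>\<open>t - u\<close> is the start of the copy of \<open>z\<close> that contains
    \<open>t\<close>.\<close>
  define c where "c = t - u + int b"
  have c: "cyc a z (c + int s) = blk w i ! s" if "s \<le> i" for s
  proof -
    have "(c + int s + int a) mod ?m = ((t + int a) - u + int (b + s)) mod ?m"
      by (simp add: c_def algebra_simps)
    also have "\<dots> = int (b + s) mod ?m" unfolding u_def
      by (metis add_diff_cancel_left' diff_add_eq mod_diff_left_eq minus_mod_eq_mult_div mod_mult_self4)
    also have "\<dots> = int (b + s)" using bi that by simp
    finally have "nat ((c + int s + int a) mod ?m) = b + s" by simp
    then show ?thesis using bi(5) that by (simp add: cyc_def)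
  qed
  have "block w L (cyc a z) c i"
    using bi(1) c[of i] c by (auto simp: block_def zeros_def nth_blk)
  moreover have "c \<le> t" "t \<le> c + int i" using bi u by (auto simp: c_def)
  moreover have "c + int i < - int a" if "t < - int a"
  proof -
    have "(t + int a) div ?m < 0" using that m by (simp add: pos_imp_zdiv_neg_iff)
    then have "?m * ((t + int a) div ?m) \<le> ?m * (- 1)" using m by (intro mult_left_mono) auto
    moreover have "t + int a = ?m * ((t + int a) div ?m) + u" by (simp add: u_def)
    ultimately have "t + int a - u \<le> - ?m" by linarith
    then show ?thesis using bi(4) by (simp add: c_def)
  qed
  ultimately show ?thesis by blast
qed

definition nxt :: "(nat \<Rightarrow> bool) \<Rightarrow> nat \<Rightarrow> (int \<Rightarrow> bool) \<Rightarrow> int \<Rightarrow> int" where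
  "nxt w L f t = t + int (THE i. block w L f t i) + 1"

lemma nxt_eq: "block w L f t i \<Longrightarrow> nxt w L f t = t + int i + 1"
  unfolding nxt_def by (subst the_equality[of _ i]) (auto dest: block_unique)

text \<open>Tile boundaries expressed through \<open>f\<close> alone, without mention of a tiling.
  The tiling of a periodic word can therefore be recovered from the word.\<close>

definition cut :: "(nat \<Rightarrow> bool) \<Rightarrow> nat \<Rightarrow> (int \<Rightarrow> bool) \<Rightarrow> int \<Rightarrow> bool" where
  "cut w L f c \<longleftrightarrow> (\<forall>t<c. nxt w L f t \<le> c)"

lemma nxt_nested:
  assumes "prenecklace w L" "above w L f" "t \<le> u" "u < nxt w L f t"
  shows "nxt w L f u \<le> nxt w L f t"
proof -
  obtain i where i: "block w L f t i" using assms by (auto simp: above_def)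
  then have n: "nxt w L f t = t + int i + 1" by (rule nxt_eq)
  then have "nat (u - t) \<le> i" using assms by simp
  then obtain r where r: "r \<le> i - nat (u - t)" "block w L f (t + int (nat (u - t))) r"
    using block_nested[OF assms(1) i, of "nat (u - t)"] by blast
  then have "nxt w L f u = u + int r + 1" using assms(3) by (intro nxt_eq) simp
  then show ?thesis using n r(1) assms(3) \<open>nat (u - t) \<le> i\<close> by linarith
qed

lemma above_cyc:
  assumes "prenecklace w L" "z \<in> tilings w L" "z \<noteq> []"
  shows "above w L (cyc a z)" "cut w L (cyc a z) (- int a)"
proof -
  have *: "\<exists>b i. block w L (cyc a z) b i \<and> b \<le> t \<and> t \<le> b + int i \<and> (t < - int a \<longrightarrow> b + int i < - int a)" for t
    using cyc_cover[OF assms(2,3)] .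
  show ab: "above w L (cyc a z)" unfolding above_def
  proof
    fix t
    obtain b i where bi: "block w L (cyc a z) b i" "b \<le> t" "t \<le> b + int i" using * by blast
    then have "nat (t - b) \<le> i" by simp
    then have "\<exists>r\<le>i - nat (t - b). block w L (cyc a z) (b + int (nat (t - b))) r"
      by (rule block_nested[OF assms(1) bi(1)])
    then show "\<exists>i. block w L (cyc a z) t i" using bi(2) by auto
  qed
  show "cut w L (cyc a z) (- int a)" unfolding cut_def
  proof (intro allI impI)
    fix t assume "t < - int a"
    then obtain b i where bi: "block w L (cyc a z) b i" "b \<le> t" "t \<le> b + int i" "b + int i < - int a"
      using * by blast
    have "nxt w L (cyc a z) t \<le> nxt w L (cyc a z) b"
      by (rule nxt_nested[OF assms(1) ab]) (use bi in \<open>auto simp: nxt_eq\<close>)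
    then show "nxt w L (cyc a z) t \<le> - int a" using bi by (simp add: nxt_eq)
  qed
qed

lemma cut_nxt:
  assumes "prenecklace w L" "above w L f" "cut w L f c"
  shows "cut w L f (nxt w L f c)"
  unfolding cut_def
proof (intro allI impI)
  fix t assume t: "t < nxt w L f c"
  obtain i where i: "block w L f c i" using assms by (auto simp: above_def)
  show "nxt w L f t \<le> nxt w L f c"
  proof (cases "t < c")
    case True
    then have "nxt w L f t \<le> c" using assms by (simp add: cut_def)
    then show ?thesis using i by (simp add: nxt_eq)
  next
    case False
    then show ?thesis using nxt_nested[OF assms(1,2)] t by simp
  qed
qed

text \<open>Take the leftmost position whose block reaches beyond \<open>t\<close>; blocks have
  length at most \<open>L\<close>, so it exists. A block from further left that crosses it would
  contain its block by nesting, hence reach beyond \<open>t\<close> too.\<close>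

lemma cut_cover:
  assumes "prenecklace w L" "above w L f"
  shows "\<exists>c\<le>t. t < nxt w L f c \<and> cut w L f c"
proof -
  let ?C = "{c. c \<le> t \<and> t < nxt w L f c}"
  have b: "nxt w L f c \<le> c + int L" "c < nxt w L f c" for c
  proof -
    obtain i where i: "block w L f c i" using assms by (auto simp: above_def)
    then show "nxt w L f c \<le> c + int L" "c < nxt w L f c" by (auto simp: nxt_eq block_def)
  qed
  have "?C \<subseteq> {t - int L..t}" using order.strict_trans2[OF _ b(1)] by force
  then have fin: "finite ?C" by (rule finite_subset) simp
  have "t \<in> ?C" using b by simp
  define c where "c = Min ?C"
  have c: "c \<in> ?C" unfolding c_def using fin \<open>t \<in> ?C\<close> by (intro Min_in) auto
  have "cut w L f c" unfolding cut_def
  proof (intro allI impI)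
    fix u assume u: "u < c"
    show "nxt w L f u \<le> c"
    proof (rule ccontr)
      assume "\<not> ?thesis"
      then have "nxt w L f c \<le> nxt w L f u" using nxt_nested[OF assms, of u c] u by simp
      then have "u \<in> ?C" using c u by auto
      then have "c \<le> u" unfolding c_def using fin by (intro Min_le)
      then show False using u by simp
    qed
  qed
  then show ?thesis using c by blast
qed

lemma cut_unique:
  assumes "cut w L f c" "c \<le> t" "t < nxt w L f c" "cut w L f c'" "c' \<le> t" "t < nxt w L f c'"
  shows "c = c'"
proof -
  have "\<not> a < b" if "cut w L f b" "b \<le> t" "t < nxt w L f a" for a b
    using that unfolding cut_def by fastforce
  then show ?thesis using assms by (meson linorder_neqE)
qed

lemma upto_tiling:
  assumes "prenecklace w L" "above w L f" "cut w L f b" "cut w L f e" "b \<le> e"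
  shows "map f [b..e - 1] \<in> tilings w L"
  using assms(3,5)
proof (induction "nat (e - b)" arbitrary: b rule: less_induct)
  case less
  show ?case
  proof (cases "b = e")
    case True then show ?thesis by (simp add: tilings.Nil)
  next
    case False
    obtain i where i: "block w L f b i" using assms by (auto simp: above_def)
    have n: "nxt w L f b = b + int i + 1" using i by (rule nxt_eq)
    have le: "b + int i + 1 \<le> e" using assms(4) less(3) False by (auto simp: cut_def n[symmetric])
    have "map f [b + int i + 1..e - 1] \<in> tilings w L"
      by (rule less(1)) (use le less(3) cut_nxt[OF assms(1,2) less(2)] n in auto)
    moreover have "i \<in> zeros w L" using i by (simp add: block_def zeros_def)
    moreover have "map f [b..b + int i] = blk w i"
    proof (rule nth_equalityI)
      fix k assume "k < length (map f [b..b + int i])"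
      then have "k \<le> i" by simp
      then show "map f [b..b + int i] ! k = blk w i ! k"
        using i by (auto simp: nth_blk block_def)
    qed simp
    moreover have "[b..e - 1] = [b..b + int i] @ [b + int i + 1..e - 1]"
      using le by (intro upto_split2) auto
    ultimately show ?thesis using tilings.Cons by simp
  qed
qed

lemma nxt_periodic:
  assumes "periodic m f" shows "nxt w L f (t + int m) = nxt w L f t + int m"
proof -
  have "f (t + int m + s) = f (t + s)" for s
    using assms[unfolded periodic_def, rule_format, of "t + s"] by (simp add: algebra_simps)
  then have "block w L f (t + int m) i = block w L f t i" for i
    by (simp add: block_def)
  then show ?thesis by (simp add: nxt_def)
qed

lemma cut_periodic:
  assumes "periodic m f" "cut w L f c" shows "cut w L f (c + int m)"
  unfolding cut_def
proof (intro allI impI)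
  fix t assume "t < c + int m"
  then have "nxt w L f (t - int m) \<le> c" using assms(2) by (simp add: cut_def)
  then show "nxt w L f t \<le> c + int m" using nxt_periodic[OF assms(1), of w L "t - int m"] by simp
qed

text \<open>Look at the tile that covers position 0: its index is \<open>i\<close>, position 0 sits
  at one of \<open>Suc i\<close> offsets in it, and the rest of the period is an arbitrary tiling of
  length \<open>m - 1 - i\<close>.\<close>

lemma card_above_periodic:
  assumes pre: "prenecklace w L" and m: "0 < m"
  shows "card {f. periodic m f \<and> above w L f} = (\<Sum>i\<in>{i\<in>zeros w L. i < m}. Suc i * tcount w L (m - 1 - i))"
proof -
  let ?I = "{i\<in>zeros w L. i < m}"
  let ?T = "\<lambda>k. {y \<in> tilings w L. length y = k}"
  define J where "J = (SIGMA i:?I. {..i} \<times> ?T (m - 1 - i))"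
  define \<Psi> where "\<Psi> = (\<lambda>(i, a, y). cyc a (blk w i @ y))"
  have nx: "nxt w L (cyc a (blk w i @ y)) (- int a) = - int a + int i + 1"
    if "i \<in> ?I" "length y = m - 1 - i" for i a y
  proof (rule nxt_eq)
    have "cyc a (blk w i @ y) (- int a + int s) = blk w i ! s" if "s \<le> i" for s
      using that \<open>i \<in> ?I\<close> \<open>length y = _\<close> by (auto simp: cyc_def nth_append)
    then show "block w L (cyc a (blk w i @ y)) (- int a) i"
      using that by (auto simp: block_def zeros_def nth_blk)
  qed
  have "bij_betw \<Psi> J {f. periodic m f \<and> above w L f}"
  proof (rule bij_betw_imageI)
    show "inj_on \<Psi> J"
    proof (rule inj_onI)
      fix u v assume "u \<in> J" "v \<in> J" and eq: "\<Psi> u = \<Psi> v"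
      then obtain i a y i' a' y' where uv: "u = (i, a, y)" "v = (i', a', y')"
        and 1: "i \<in> ?I" "a \<le> i" "y \<in> tilings w L" "length y = m - 1 - i"
        and 2: "i' \<in> ?I" "a' \<le> i'" "y' \<in> tilings w L" "length y' = m - 1 - i'"
        unfolding J_def by auto
      define f where "f = \<Psi> u"
      have f1: "f = cyc a (blk w i @ y)" and f2: "f = cyc a' (blk w i' @ y')"
        using eq by (auto simp: f_def uv \<Psi>_def)
      have t1: "blk w i @ y \<in> tilings w L" and t2: "blk w i' @ y' \<in> tilings w L"
        using 1 2 by (auto intro: tilings.Cons)
      have n1: "nxt w L f (- int a) = - int a + int i + 1" using nx 1 f1 by simp
      have n2: "nxt w L f (- int a') = - int a' + int i' + 1" using nx 2 f2 by simp
      \<comment> \<open>Both are cuts, and both are the left end of the tile over position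
        0.\<close>
      have "- int a = - int a'"
      proof (rule cut_unique[where t = 0])
        show "cut w L f (- int a)" unfolding f1 using above_cyc(2)[OF pre t1] by (simp add: blk_def)
        show "cut w L f (- int a')" unfolding f2 using above_cyc(2)[OF pre t2] by (simp add: blk_def)
      qed (use n1 n2 1 2 in auto)
      then have a: "a = a'" by simp
      then have i: "i = i'" using n1 n2 by simp
      have "blk w i @ y = blk w i' @ y'"
      proof (rule nth_equalityI)
        show len: "length (blk w i @ y) = length (blk w i' @ y')" using i 1 2 by simp
        fix k assume k: "k < length (blk w i @ y)"
        have "f (int k - int a) = (blk w i @ y) ! k" using k by (simp add: f1 cyc_def)
        moreover have "f (int k - int a) = (blk w i' @ y') ! k" using k len a by (simp add: f2 cyc_def)
        ultimately show "(blk w i @ y) ! k = (blk w i' @ y') ! k" by simp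
      qed
      then show "u = v" using a i uv by simp
    qed
  next
    show "\<Psi> ` J = {f. periodic m f \<and> above w L f}"
    proof (intro set_eqI iffI)
      fix f assume "f \<in> \<Psi> ` J"
      then obtain i a y where f: "f = cyc a (blk w i @ y)"
        and 1: "i \<in> ?I" "a \<le> i" "y \<in> tilings w L" "length y = m - 1 - i"
        unfolding J_def \<Psi>_def by auto
      have t1: "blk w i @ y \<in> tilings w L" using 1 by (auto intro: tilings.Cons)
      have l: "length (blk w i @ y) = m" using 1 by simp
      show "f \<in> {f. periodic m f \<and> above w L f}"
        using above_cyc(1)[OF pre t1] periodic_cyc[of "blk w i @ y" a]
        unfolding l by (simp add: f blk_def)
    next
      fix f assume "f \<in> {f. periodic m f \<and> above w L f}"
      then have per: "periodic m f" and ab: "above w L f" by auto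
      obtain c where c: "c \<le> 0" "0 < nxt w L f c" "cut w L f c" using cut_cover[OF pre ab, of 0] by auto
      obtain i where i: "block w L f c i" using ab by (auto simp: above_def)
      have n: "nxt w L f c = c + int i + 1" using i by (rule nxt_eq)
      have cm: "cut w L f (c + int m)" using cut_periodic[OF per c(3)] .
      then have im: "c + int i + 1 \<le> c + int m" using m by (auto simp: cut_def n[symmetric])
      define y where "y = map f [c + int i + 1..c + int m - 1]"
      have y: "y \<in> tilings w L" unfolding y_def
        by (rule upto_tiling[OF pre ab _ cm im]) (use cut_nxt[OF pre ab c(3)] n in simp)
      have ly: "length y = m - 1 - i" using im by (simp add: y_def)
      have iz: "i \<in> ?I" using i im by (auto simp: block_def zeros_def)
      have beq: "blk w i @ y = map f [c..c + int m - 1]"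
      proof -
        have "map f [c..c + int i] = blk w i"
        proof (rule nth_equalityI)
          fix k assume "k < length (map f [c..c + int i])"
          then have "k \<le> i" by simp
          then show "map f [c..c + int i] ! k = blk w i ! k"
            using i by (auto simp: nth_blk block_def)
        qed simp
        moreover have "[c..c + int m - 1] = [c..c + int i] @ [c + int i + 1..c + int m - 1]"
          using im by (intro upto_split2) auto
        ultimately show ?thesis by (simp add: y_def)
      qed
      have "f = cyc (nat (- c)) (blk w i @ y)"
      proof
        fix t
        have "cyc (nat (- c)) (blk w i @ y) t = f (c + (t - c) mod int m)"
          using c(1) m unfolding beq cyc_def by (simp add: nat_less_iff)
        then show "f t = cyc (nat (- c)) (blk w i @ y) t"
          using periodic_mod[OF per, of c "t - c"] by simp
      qed
      moreover have "(i, nat (- c), y) \<in> J" using y ly iz c n by (auto simp: J_def)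
      ultimately show "f \<in> \<Psi> ` J" by (force simp: \<Psi>_def)
    qed
  qed
  then have "card {f. periodic m f \<and> above w L f} = card J" by (simp add: bij_betw_same_card)
  also have "\<dots> = (\<Sum>i\<in>?I. Suc i * tcount w L (m - 1 - i))"
  proof -
    have "finite (?T k)" for k
      by (rule finite_subset[OF _ finite_bool_lists[of k]]) auto
    then have "card J = (\<Sum>i\<in>?I. card ({..i} \<times> ?T (m - 1 - i)))"
      unfolding J_def by (intro card_SigmaI) auto
    then show ?thesis by (simp add: card_cartesian_product tcount_def)
  qed
  finally show ?thesis .
qed

section \<open>Counting necklaces above a prefix\<close>

lemma necklace_class:
  assumes "length x = n"
  shows "necklace_rel n `` {x} = {rotate k x | k. True}"
proof (intro set_eqI iffI)
  fix y assume "y \<in> necklace_rel n `` {x}"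
  then obtain x1 x2 where "x = x1 @ x2" "y = x2 @ x1" by (auto simp: necklace_rel_def)
  then have "y = rotate (length x1) x" by (simp add: rotate_append)
  then show "y \<in> {rotate k x | k. True}" by blast
next
  fix y assume "y \<in> {rotate k x | k. True}"
  then obtain k where k: "y = rotate k x" by blast
  have "x = take (k mod length x) x @ drop (k mod length x) x" by simp
  moreover have "y = drop (k mod length x) x @ take (k mod length x) x"
    unfolding k by (rule rotate_drop_take)
  ultimately show "y \<in> necklace_rel n `` {x}"
    using assms k unfolding necklace_rel_def by (auto simp del: append_take_drop_id)
qed

lemma equiv_necklace_rel: "equiv (bin_strings n) (necklace_rel n)"
proof (rule equivI)
  show "necklace_rel n \<subseteq> bin_strings n \<times> bin_strings n"
    by (auto simp: necklace_rel_def bin_strings_def)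
  show "refl_on (bin_strings n) (necklace_rel n)"
  proof (rule refl_onI)
    fix x assume "x \<in> bin_strings n"
    then show "(x, x) \<in> necklace_rel n"
      using append_Nil[of x] append_Nil2[of x] unfolding necklace_rel_def bin_strings_def by blast
  qed
  show "sym (necklace_rel n)" by (auto simp: necklace_rel_def sym_def)
  show "trans (necklace_rel n)"
  proof (rule transI)
    fix x y z assume xy: "(x, y) \<in> necklace_rel n" and yz: "(y, z) \<in> necklace_rel n"
    then have l: "length x = n" "length y = n" by (auto simp: necklace_rel_def)
    obtain k where "y = rotate k x" using xy necklace_class[OF l(1)] by blast
    moreover obtain m where "z = rotate m y" using yz necklace_class[OF l(2)] by blast
    ultimately have "z = rotate (m + k) x" by (simp add: rotate_rotate)
    then have "z \<in> necklace_rel n `` {x}" using necklace_class[OF l(1)] by blast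
    then show "(x, z) \<in> necklace_rel n" by simp
  qed
qed

lemma finite_bin_strings [simp]: "finite (bin_strings n)"
  by (simp add: bin_strings_def finite_bool_lists)

lemma finite_necklaces [simp]: "finite (necklaces n)"
  unfolding necklaces_def
  by (rule finite_quotient) (use equivE[OF equiv_necklace_rel] in auto)

lemma necklaceE:
  assumes "c \<in> necklaces n"
  obtains x where "length x = n" "x \<in> c" "c = {rotate k x | k. True}"
proof -
  obtain x where x: "x \<in> bin_strings n" "c = necklace_rel n `` {x}"
    using assms unfolding necklaces_def by (rule quotientE)
  then have l: "length x = n" by (simp add: bin_strings_def)
  moreover have "c = {rotate k x | k. True}" using x necklace_class[OF l] by simp
  moreover have "x \<in> c" using calculation(2) by (auto intro: exI[of _ 0])
  ultimately show ?thesis using that by blast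
qed

lemma necklace_eq_class:
  assumes "c \<in> necklaces n" "x \<in> c"
  shows "length x = n" "c = {rotate k x | k. True}"
proof -
  obtain y where y: "length y = n" "y \<in> c" "c = {rotate k y | k. True}" using assms(1) by (rule necklaceE)
  then show l: "length x = n" using assms(2) by auto
  have "c = necklace_rel n `` {x}"
    using assms unfolding necklaces_def
    by (metis Image_singleton_iff equiv_class_eq_iff equiv_necklace_rel quotientE)
  then show "c = {rotate k x | k. True}" using necklace_class[OF l] by simp
qed

text \<open>The rotation amounts that carry \<open>x\<close> to \<open>y\<close> are a coset of the
  stabilizer of \<open>y\<close>, shifted by \<open>m\<close> modulo \<open>n\<close>.\<close>

lemma card_rotations_eq:
  fixes x :: "'a list"
  assumes n: "0 < n" "length x = n" and y: "y = rotate m x"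
  shows "card {k. k < n \<and> rotate k x = y} = card {k. k < n \<and> rotate k y = y}"
proof (rule bij_betw_same_card[OF bij_betw_byWitness
      [where f = "\<lambda>k. (k + (n - m mod n)) mod n" and f' = "\<lambda>k. (k + m) mod n"]])
  have r: "rotate (k mod n) z = rotate k z" if "length z = n" for k and z :: "'a list"
    using that by (metis rotate_conv_mod)
  have ly: "length y = n" using n y by simp
  have m: "n - m mod n + m mod n = n" using n by (simp add: less_imp_le)
  have rev: "rotate (n - m mod n) y = x"
  proof -
    have "rotate (n - m mod n) y = rotate (n - m mod n + m mod n) x"
      using r[OF n(2), of m] by (metis rotate_rotate y)
    then show ?thesis using m n r[OF n(2), of n] by simp
  qed
  have 1: "((k + (n - m mod n)) mod n + m) mod n = k" if "k < n" for k
  proof -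
    have "((k + (n - m mod n)) mod n + m) mod n = (k + (n - m mod n) + m mod n) mod n"
      by (metis mod_add_eq mod_mod_trivial)
    also have "\<dots> = k" using m that by (metis add.assoc mod_add_self2 mod_less)
    finally show ?thesis .
  qed
  show "\<forall>k\<in>{k. k < n \<and> rotate k x = y}. ((k + (n - m mod n)) mod n + m) mod n = k" using 1 by blast
  have "((k + m) mod n + (n - m mod n)) mod n = k" if "k < n" for k
  proof -
    have "((k + m) mod n + (n - m mod n)) mod n = (k + m mod n + (n - m mod n)) mod n"
      by (metis mod_add_left_eq mod_add_right_eq)
    also have "\<dots> = k" using m that by (metis add.assoc add.commute mod_add_self2 mod_less)
    finally show ?thesis .
  qed
  then show "\<forall>k\<in>{k. k < n \<and> rotate k y = y}. ((k + m) mod n + (n - m mod n)) mod n = k" by blast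
  show "(\<lambda>k. (k + (n - m mod n)) mod n) ` {k. k < n \<and> rotate k x = y} \<subseteq> {k. k < n \<and> rotate k y = y}"
  proof clarify
    fix k assume k: "k < n" "y = rotate k x"
    have "rotate ((k + (n - m mod n)) mod n) y = rotate k (rotate (n - m mod n) y)"
      using r[OF ly] by (simp add: rotate_rotate)
    then show "(k + (n - m mod n)) mod n < n \<and> rotate ((k + (n - m mod n)) mod n) (rotate k x) = rotate k x"
      using rev k n by simp
  qed
  show "(\<lambda>k. (k + m) mod n) ` {k. k < n \<and> rotate k y = y} \<subseteq> {k. k < n \<and> rotate k x = y}"
  proof clarify
    fix k assume k: "k < n" "rotate k y = y"
    have "rotate ((k + m) mod n) x = rotate k y"
      using r[OF n(2)] by (simp add: rotate_rotate y)
    then show "(k + m) mod n < n \<and> rotate ((k + m) mod n) x = y" using k n by simp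
  qed
qed

text \<open>The pairs of a string and a rotation amount fixing it are counted twice; grouped by
  classes, each class contributes \<open>n\<close> by the orbit-stabilizer argument.\<close>

lemma burnside:
  assumes n: "0 < n" and C: "C \<subseteq> necklaces n"
  shows "n * card C = (\<Sum>k=1..n. card {x \<in> \<Union>C. rotate k x = x})"
proof -
  have finC: "finite C" using C by (rule finite_subset) simp
  have sub: "\<Union>C \<subseteq> bin_strings n" using C necklace_eq_class(1) by (auto simp: bin_strings_def)
  then have finU: "finite (\<Union>C)" by (rule finite_subset) simp
  have orbit: "(\<Sum>y\<in>c. card {k. k < n \<and> rotate k y = y}) = n" if c: "c \<in> C" for c
  proof -
    obtain x where x: "length x = n" "x \<in> c" "c = {rotate k x | k. True}"
      using c C by (blast elim: necklaceE)
    have fc: "finite c" using finU c by (meson Union_upper finite_subset)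
    have "n = card (\<Union>y\<in>c. {k. k < n \<and> rotate k x = y})"
    proof -
      have "(\<Union>y\<in>c. {k. k < n \<and> rotate k x = y}) = {..<n}" unfolding x(3) by auto
      then show ?thesis by simp
    qed
    also have "\<dots> = (\<Sum>y\<in>c. card {k. k < n \<and> rotate k x = y})"
      by (rule card_UN_disjoint) (use fc in auto)
    also have "\<dots> = (\<Sum>y\<in>c. card {k. k < n \<and> rotate k y = y})"
    proof (rule sum.cong[OF refl])
      fix y assume "y \<in> c"
      then obtain m where "y = rotate m x" using x by blast
      then show "card {k. k < n \<and> rotate k x = y} = card {k. k < n \<and> rotate k y = y}"
        by (rule card_rotations_eq[OF n x(1)])
    qed
    finally show ?thesis by simp
  qed
  have disj: "\<forall>c\<in>C. \<forall>d\<in>C. c \<noteq> d \<longrightarrow> c \<inter> d = {}"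
    using C necklace_eq_class(2) by blast
  have "n * card C = (\<Sum>c\<in>C. \<Sum>y\<in>c. card {k. k < n \<and> rotate k y = y})"
    using orbit by simp
  also have "\<dots> = (\<Sum>y\<in>\<Union>C. card {k. k < n \<and> rotate k y = y})"
    using finU disj by (subst sum.Union_disjoint) (auto intro: finite_subset)
  also have "\<dots> = (\<Sum>y\<in>\<Union>C. \<Sum>k<n. if rotate k y = y then 1 else 0)"
    by (rule sum.cong[OF refl])
      (simp only: card_eq_sum flip: sum.inter_filter[OF finite_lessThan], simp add: lessThan_def)
  also have "\<dots> = (\<Sum>k<n. \<Sum>y\<in>\<Union>C. if rotate k y = y then 1 else 0)"
    by (rule sum.swap)
  also have "\<dots> = (\<Sum>k<n. card {x \<in> \<Union>C. rotate k x = x})"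
    by (simp only: card_eq_sum sum.inter_filter[OF finU])
  \<comment> \<open>The identity rotation is listed as \<open>k = n\<close> instead of
    \<open>k = 0\<close>, since Euclid's algorithm by subtraction will need positive
    arguments.\<close>
  also have "\<dots> = (\<Sum>k=1..n. card {x \<in> \<Union>C. rotate k x = x})"
  proof -
    let ?g = "\<lambda>k. card {x \<in> \<Union>C. rotate k x = x}"
    have "{x \<in> \<Union>C. rotate n x = x} = {x \<in> \<Union>C. rotate 0 x = x}"
      using sub by (auto simp: bin_strings_def)
    then have "?g n = ?g 0" by simp
    moreover have "(\<Sum>k<Suc n. ?g k) = ?g 0 + (\<Sum>k=1..n. ?g k)"
      by (subst sum.lessThan_Suc_shift) (simp add: sum.atLeast1_atMost_eq)
    ultimately show ?thesis by simp
  qed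
  finally show ?thesis .
qed

section \<open>Comparison with a prefix, and the number of necklaces above it\<close>

definition lgt :: "nat \<Rightarrow> (nat \<Rightarrow> bool) \<Rightarrow> (nat \<Rightarrow> bool) \<Rightarrow> bool" where
  "lgt L x w \<longleftrightarrow> (\<exists>i<L. \<not> w i \<and> x i \<and> (\<forall>s<i. x s = w s))"

definition lge :: "nat \<Rightarrow> (nat \<Rightarrow> bool) \<Rightarrow> (nat \<Rightarrow> bool) \<Rightarrow> bool" where
  "lge L x w \<longleftrightarrow> lgt L x w \<or> (\<forall>s<L. x s = w s)"

definition gt_necklaces :: "nat \<Rightarrow> nat \<Rightarrow> (nat \<Rightarrow> bool) \<Rightarrow> bool list set set" where
  "gt_necklaces n L w = {c \<in> necklaces n. \<forall>x\<in>c. lgt L ((!) x) w}"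

definition ge_necklaces :: "nat \<Rightarrow> nat \<Rightarrow> (nat \<Rightarrow> bool) \<Rightarrow> bool list set set" where
  "ge_necklaces n L w = {c \<in> necklaces n. \<forall>x\<in>c. lge L ((!) x) w}"

lemma nth_rotate_cyc:
  assumes "s < length x"
  shows "rotate k x ! s = cyc 0 x (int k + int s)"
  using assms by (simp add: nth_rotate cyc_def nat_mod_distrib nat_add_distrib flip: of_nat_add)

text \<open>Only positions modulo \<open>length x\<close> matter, and \<open>rotate k x\<close>
  reads the periodic word from \<open>k\<close> on. The bound on \<open>L\<close> keeps each
  comparison within one period.\<close>

lemma above_cyc_iff:
  assumes "0 < length x" "L \<le> length x"
  shows "above w L (cyc 0 x) \<longleftrightarrow> (\<forall>k. lgt L ((!) (rotate k x)) w)"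
proof -
  have blk: "(\<exists>i. block w L (cyc 0 x) (int k) i) \<longleftrightarrow> lgt L ((!) (rotate k x)) w" for k
  proof -
    have "block w L (cyc 0 x) (int k) i \<longleftrightarrow>
        i < L \<and> \<not> w i \<and> rotate k x ! i \<and> (\<forall>s<i. rotate k x ! s = w s)" for i
      using assms nth_rotate_cyc[of _ x k] unfolding block_def by auto
    then show ?thesis unfolding lgt_def by blast
  qed
  have "cyc 0 x (t + u) = cyc 0 x (int (nat (t mod int (length x))) + u)" for t u
    using assms by (simp add: cyc_def mod_add_left_eq)
  then have "block w L (cyc 0 x) t = block w L (cyc 0 x) (int (nat (t mod int (length x))))" for t
    unfolding block_def by presburger
  then show ?thesis using blk unfolding above_def by metis
qed

lemma rotate_fixed_iff:
  assumes "0 < length x"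
  shows "rotate k x = x \<longleftrightarrow> periodic k (cyc 0 x)"
proof
  assume r: "rotate k x = x"
  show "periodic k (cyc 0 x)" unfolding periodic_def
  proof
    fix t
    define u where "u = nat (t mod int (length x))"
    have u: "u < length x" "int u = t mod int (length x)" using assms by (auto simp: u_def nat_less_iff)
    have "cyc 0 x (t + int k) = cyc 0 x (int k + int u)"
      by (simp add: cyc_def u mod_add_right_eq add.commute)
    also have "\<dots> = x ! u" using nth_rotate_cyc[OF u(1), of k] r by simp
    also have "\<dots> = cyc 0 x t" by (simp add: cyc_def u_def)
    finally show "cyc 0 x (t + int k) = cyc 0 x t" .
  qed
next
  assume p: "periodic k (cyc 0 x)"
  show "rotate k x = x"
  proof (rule nth_equalityI)
    fix s assume "s < length (rotate k x)"
    then have s: "s < length x" by simp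
    have "rotate k x ! s = cyc 0 x (int s + int k)" using nth_rotate_cyc[OF s] by (simp add: add.commute)
    also have "\<dots> = x ! s" using p s by (simp add: periodic_def cyc_def)
    finally show "rotate k x ! s = x ! s" .
  qed simp
qed

text \<open>Bezout's identity, whose coefficients may be negative; \<open>periodic_mult\<close>
  covers all integer multiples.\<close>

lemma periodic_gcd: "periodic (gcd n k) f \<longleftrightarrow> periodic n f \<and> periodic k f"
proof
  assume g: "periodic (gcd n k) f"
  have "periodic m f" if m: "gcd n k dvd m" for m
  proof -
    obtain d where "m = gcd n k * d" using m by blast
    then show ?thesis using periodic_mult[OF g, of _ "int d"] by (simp add: periodic_def)
  qed
  then show "periodic n f \<and> periodic k f" by simp
next
  assume p: "periodic n f \<and> periodic k f"
  obtain u v where "u * int n + v * int k = gcd (int n) (int k)" using bezout_int by blast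
  then have g: "int (gcd n k) = int n * u + int k * v" by (simp add: gcd_int_int_eq mult.commute)
  have "f (t + int (gcd n k)) = f t" for t
    using periodic_mult[of k f "t + int n * u" v] periodic_mult[of n f t u] p
    unfolding g by (simp add: add.assoc)
  then show "periodic (gcd n k) f" by (simp add: periodic_def)
qed

definition ccount :: "(nat \<Rightarrow> bool) \<Rightarrow> nat \<Rightarrow> nat \<Rightarrow> nat" where
  "ccount w L m = (\<Sum>i\<in>{i\<in>zeros w L. i < m}. Suc i * tcount w L (m - 1 - i))"

text \<open>The strings in these classes are those whose periodic extension is \<open>above\<close>.
  Among them rotation by \<open>k\<close> fixes the ones of period \<open>k\<close>, which together
  with period \<open>n\<close> means period \<open>gcd n k\<close>.\<close>

lemma card_gt_necklaces:
  assumes n: "0 < n" and L: "L \<le> n" and pre: "prenecklace w L"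
  shows "n * card (gt_necklaces n L w) = (\<Sum>k=1..n. ccount w L (gcd n k))"
proof -
  let ?C = "gt_necklaces n L w"
  have U: "x \<in> \<Union>?C \<longleftrightarrow> length x = n \<and> above w L (cyc 0 x)" for x
  proof
    assume "x \<in> \<Union>?C"
    then obtain c where c: "c \<in> necklaces n" "x \<in> c" "\<forall>x\<in>c. lgt L ((!) x) w"
      by (auto simp: gt_necklaces_def)
    then show "length x = n \<and> above w L (cyc 0 x)"
      using necklace_eq_class[OF c(1,2)] above_cyc_iff[of x L w] n L by auto
  next
    assume x: "length x = n \<and> above w L (cyc 0 x)"
    let ?c = "necklace_rel n `` {x}"
    have c: "?c = {rotate k x | k. True}" using necklace_class x by blast
    have "?c \<in> necklaces n" unfolding necklaces_def
      by (rule quotientI) (use x in \<open>simp add: bin_strings_def\<close>)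
    moreover have "\<forall>x\<in>?c. lgt L ((!) x) w"
      using x above_cyc_iff[of x L w] n L unfolding c by auto
    moreover have "x \<in> ?c" unfolding c by (auto intro: exI[of _ 0])
    ultimately show "x \<in> \<Union>?C" unfolding gt_necklaces_def by blast
  qed
  have "card {x \<in> \<Union>?C. rotate k x = x} = ccount w L (gcd n k)" for k
  proof -
    have "bij_betw (cyc 0) {x \<in> \<Union>?C. rotate k x = x} {f. periodic (gcd n k) f \<and> above w L f}"
    proof (rule bij_betw_imageI)
      show "inj_on (cyc 0) {x \<in> \<Union>?C. rotate k x = x}"
      proof (rule inj_onI)
        fix x y assume "x \<in> {x \<in> \<Union>?C. rotate k x = x}" "y \<in> {x \<in> \<Union>?C. rotate k x = x}"
          and eq: "cyc 0 x = cyc 0 y"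
        then have l: "length x = n" "length y = n" using U by blast+
        show "x = y"
        proof (rule nth_equalityI)
          fix i assume "i < length x"
          then show "x ! i = y ! i" using fun_cong[OF eq, of "int i"] l by (simp add: cyc_def)
        qed (use l in simp)
      qed
      show "cyc 0 ` {x \<in> \<Union>?C. rotate k x = x} = {f. periodic (gcd n k) f \<and> above w L f}"
      proof (intro set_eqI iffI)
        fix f assume "f \<in> cyc 0 ` {x \<in> \<Union>?C. rotate k x = x}"
        then obtain x where x: "f = cyc 0 x" "x \<in> \<Union>?C" "rotate k x = x" by blast
        then have l: "length x = n" "above w L f" using U by blast+
        show "f \<in> {f. periodic (gcd n k) f \<and> above w L f}"
          using x l n rotate_fixed_iff[of x k] periodic_cyc[of x 0] by (simp add: periodic_gcd)
      next
        fix f assume "f \<in> {f. periodic (gcd n k) f \<and> above w L f}"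
        then have f: "periodic n f" "periodic k f" "above w L f" by (auto simp: periodic_gcd)
        define x where "x = map (\<lambda>i. f (int i)) [0..<n]"
        have "cyc 0 x t = f t" for t
          using n periodic_mod[OF f(1), of 0 t] by (simp add: cyc_def x_def nat_less_iff)
        then have "f = cyc 0 x" by auto
        moreover from this have "x \<in> {x \<in> \<Union>?C. rotate k x = x}"
          using f n U[of x] rotate_fixed_iff[of x k] by (simp add: x_def)
        ultimately show "f \<in> cyc 0 ` {x \<in> \<Union>?C. rotate k x = x}" by blast
      qed
    qed
    then have "card {x \<in> \<Union>?C. rotate k x = x} = card {f. periodic (gcd n k) f \<and> above w L f}"
      by (rule bij_betw_same_card)
    also have "\<dots> = ccount w L (gcd n k)"
      unfolding ccount_def by (rule card_above_periodic[OF pre]) (use n in simp)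
    finally show ?thesis .
  qed
  moreover have "?C \<subseteq> necklaces n" by (auto simp: gt_necklaces_def)
  ultimately show ?thesis using burnside[OF n] by simp
qed

lemma gt_necklaces_0: "gt_necklaces n 0 w = {}"
proof -
  have "c \<noteq> {}" if "c \<in> necklaces n" for c using that by (blast elim: necklaceE)
  then show ?thesis by (auto simp: gt_necklaces_def lgt_def)
qed

lemma lgt_cong: "(\<And>i. i < L \<Longrightarrow> w i = v i) \<Longrightarrow> lgt L x w = lgt L x v"
  unfolding lgt_def by (auto 0 3)

section \<open>Extending the prefix by one bit\<close>

lemma lgt_Suc_True: "w L \<Longrightarrow> lgt (Suc L) x w = lgt L x w"
  unfolding lgt_def by (auto simp: less_Suc_eq)

text \<open>\<open>w 0\<close> is the least extension of \<open>w\<close>, so the weak comparison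
  does not change. The next lemma uses that \<open>w 1\<close> is the immediate successor of
  \<open>w 0\<close> among words of length \<open>L + 1\<close>.\<close>

lemma lge_Suc_False: "\<not> w L \<Longrightarrow> lge (Suc L) x w = lge L x w"
  unfolding lge_def lgt_def by (auto simp: less_Suc_eq)

lemma lge_Suc_upd: "\<not> w L \<Longrightarrow> lge (Suc L) x (w(L := True)) = lgt (Suc L) x w"
  unfolding lge_def lgt_def by (auto simp: less_Suc_eq)

lemma lgt_upd: "lgt L x (w(L := b)) = lgt L x w"
  by (rule lgt_cong) simp

lemma necklaces_Suc_False: "\<not> w L \<Longrightarrow> ge_necklaces n (Suc L) w = ge_necklaces n L w"
  by (simp add: ge_necklaces_def lge_Suc_False)

lemma gt_necklaces_Suc_True: "gt_necklaces n (Suc L) (w(L := True)) = gt_necklaces n L w"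
  by (simp add: gt_necklaces_def lgt_Suc_True lgt_upd)

lemma ge_necklaces_Suc_True: "\<not> w L \<Longrightarrow> ge_necklaces n (Suc L) (w(L := True)) = gt_necklaces n (Suc L) w"
  by (simp add: ge_necklaces_def gt_necklaces_def lge_Suc_upd)

text \<open>\<open>max 1 L\<close> gives the empty prefix the period 1; otherwise \<open>L\<close>
  itself is always a period, vacuously.\<close>

definition min_period :: "(nat \<Rightarrow> bool) \<Rightarrow> nat \<Rightarrow> nat \<Rightarrow> bool" where
  "min_period w L p \<longleftrightarrow> 0 < p \<and> p \<le> max 1 L \<and> (\<forall>u. u + p < L \<longrightarrow> w (u + p) = w u) \<and>
     (\<forall>s. 0 < s \<and> s < p \<longrightarrow> (\<exists>u. u + s < L \<and> w (u + s) \<noteq> w u))"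

text \<open>Every period \<open>s\<close> other than \<open>p\<close> is longer. Shifting by
  \<open>p\<close> turns it into an overlap by \<open>s - p\<close> that ends at
  \<open>L - p\<close>, where \<open>w\<close> has a 0, and the prenecklace property carries this 0
  over to \<open>L - s\<close>.\<close>

lemma period_bit:
  assumes pre: "prenecklace w L" and p: "min_period w L p" and L: "0 < L" "\<not> w (L - p)"
    and s: "0 < s" "s \<le> L" "\<forall>u. u + s < L \<longrightarrow> w (u + s) = w u"
  shows "\<not> w (L - s)"
proof -
  have p': "0 < p" "p \<le> L" "\<And>u. u + p < L \<Longrightarrow> w (u + p) = w u" using p L by (auto simp: min_period_def)
  have "\<not> s < p" using p s unfolding min_period_def by blast
  then consider "s = p" | "p < s" by linarith
  then show ?thesis
  proof cases
    case 1 then show ?thesis using L by simp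
  next
    case 2
    have "w (s - p + u) = w u" if "u < L - p - (s - p)" for u
    proof -
      have "w (s - p + u) = w (u + s)" using p'(3)[of "s - p + u"] that 2 by (simp add: algebra_simps)
      also have "\<dots> = w u" using s that 2 by simp
      finally show ?thesis .
    qed
    then have "\<not> w (L - p - (s - p))"
      using pre[unfolded prenecklace_def, rule_format, of "L - p" "s - p"] L p' s 2 by simp
    then show ?thesis using 2 by simp
  qed
qed

lemma prenecklace_Suc_True: "prenecklace w L \<Longrightarrow> w L \<Longrightarrow> prenecklace w (Suc L)"
  unfolding prenecklace_def by (metis less_Suc_eq)

text \<open>The new 0 is a constraint for every period of \<open>w\<close> at once; by
  \<open>period_bit\<close> it suffices to test the minimal one.\<close>

lemma prenecklace_Suc_False:
  assumes pre: "prenecklace w L" and p: "min_period w L p" and b: "L = 0 \<or> \<not> w (L - p)"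
  shows "prenecklace w (Suc L)"
  unfolding prenecklace_def
proof (intro allI impI)
  fix i s assume i: "i < Suc L" and s: "\<not> w i \<and> 0 < s \<and> s \<le> i \<and> (\<forall>u<i - s. w (s + u) = w u)"
  show "\<not> w (i - s)"
  proof (cases "i = L")
    case True
    then have "L \<noteq> 0" using s by simp
    then have L: "0 < L" "\<not> w (L - p)" using b by auto
    have "\<forall>u. u + s < L \<longrightarrow> w (u + s) = w u" using s True by (simp add: add.commute less_diff_conv)
    then show ?thesis using period_bit[OF pre p L] s True by blast
  next
    case False
    then show ?thesis using i s pre[unfolded prenecklace_def, rule_format, of i s] by simp
  qed
qed

lemma min_period_Suc_same:
  assumes p: "min_period w L p" and b: "L \<noteq> 0 \<Longrightarrow> w L = w (L - p)"
  shows "min_period w (Suc L) p"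
  unfolding min_period_def
proof (intro conjI allI impI)
  show "0 < p" "p \<le> max 1 (Suc L)" using p by (auto simp: min_period_def)
  fix u assume u: "u + p < Suc L"
  show "w (u + p) = w u"
  proof (cases "u + p = L")
    case True then show ?thesis using b \<open>0 < p\<close> by auto
  next
    case False then show ?thesis using u p by (simp add: min_period_def)
  qed
next
  fix s assume "0 < s \<and> s < p"
  then obtain u where "u + s < L" "w (u + s) \<noteq> w u" using p unfolding min_period_def by blast
  then show "\<exists>u. u + s < Suc L \<and> w (u + s) \<noteq> w u" by (intro exI[of _ u]) simp
qed

text \<open>The case of Duval's algorithm in which a Lyndon word arises. A proper period of the
  extended word would be a period of \<open>w\<close> predicting a 0, by \<open>period_bit\<close>,
  where the new bit is 1.\<close>

lemma min_period_Suc_new: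
  assumes pre: "prenecklace w L" and p: "min_period w L p" and b: "L = 0 \<or> \<not> w (L - p)" and w: "w L"
  shows "min_period w (Suc L) (Suc L)"
  unfolding min_period_def
proof (intro conjI allI impI)
  fix s assume s: "0 < s \<and> s < Suc L"
  then have L: "0 < L" "\<not> w (L - p)" using b by auto
  show "\<exists>u. u + s < Suc L \<and> w (u + s) \<noteq> w u"
  proof (rule ccontr)
    assume "\<not> ?thesis"
    then have eq: "\<And>u. u + s < Suc L \<Longrightarrow> w (u + s) = w u" by blast
    then have "\<not> w (L - s)" using period_bit[OF pre p L, of s] s by simp
    moreover have "w (L - s)" using eq[of "L - s"] s w by simp
    ultimately show False by simp
  qed
qed auto

text \<open>A rotation starting with \<open>w 0\<close> would become smaller than \<open>w\<close> when shifted by the period.\<close>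

lemma forced_bit:
  assumes L: "0 < L" "L < n" and p: "min_period w L p" and w: "w (L - p)" "\<not> w L"
  shows "gt_necklaces n (Suc L) w = ge_necklaces n L w"
proof
  show "gt_necklaces n (Suc L) w \<subseteq> ge_necklaces n L w"
    unfolding gt_necklaces_def ge_necklaces_def
    using lge_Suc_False[of w L, OF w(2)] by (auto simp: lge_def)
  show "ge_necklaces n L w \<subseteq> gt_necklaces n (Suc L) w"
  proof
    fix c assume c: "c \<in> ge_necklaces n L w"
    then have cn: "c \<in> necklaces n" and ge: "\<And>x. x \<in> c \<Longrightarrow> lge L ((!) x) w"
      by (auto simp: ge_necklaces_def)
    have p': "0 < p" "p \<le> L" "\<And>u. u + p < L \<Longrightarrow> w (u + p) = w u" using p L by (auto simp: min_period_def)
    have "lgt (Suc L) ((!) x) w" if x: "x \<in> c" for x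
    proof (rule ccontr)
      assume n: "\<not> lgt (Suc L) ((!) x) w"
      have "lge (Suc L) ((!) x) w" using ge[OF x] lge_Suc_False[of w L, OF w(2)] by blast
      then have eq: "\<And>s. s \<le> L \<Longrightarrow> x ! s = w s" using n by (simp add: lge_def less_Suc_eq_le)
      have lx: "length x = n" using necklace_eq_class[OF cn x] by simp
      have y: "rotate p x \<in> c" using necklace_eq_class[OF cn x] by blast
      have ys: "rotate p x ! s = w (p + s)" if "s \<le> L - p" for s
        using that eq[of "p + s"] p' L lx by (simp add: nth_rotate)
      have yw: "rotate p x ! s = w s" if "s < L - p" for s
        using ys[of s] p'(3)[of s] that by (simp add: add.commute)
      have last: "\<not> rotate p x ! (L - p)" using ys[of "L - p"] p' w by simp
      have "\<not> lgt L ((!) (rotate p x)) w"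
      proof
        assume "lgt L ((!) (rotate p x)) w"
        then obtain i where i: "i < L" "\<not> w i" "rotate p x ! i" "\<forall>s<i. rotate p x ! s = w s"
          by (auto simp: lgt_def)
        consider "i < L - p" | "i = L - p" | "L - p < i" by linarith
        then show False
        proof cases
          case 1 then show ?thesis using i yw by simp
        next
          case 2 then show ?thesis using i last by simp
        next
          case 3 then show ?thesis using i last w by blast
        qed
      qed
      moreover have "\<not> (\<forall>s<L. rotate p x ! s = w s)" using last w p' L(1)
        by (metis diff_less)
      ultimately show False using ge[OF y] by (auto simp only: lge_def)
    qed
    then show "c \<in> gt_necklaces n (Suc L) w" using cn by (simp add: gt_necklaces_def)
  qed
qed

section \<open>The j-th necklace in decreasing order of smallest rotations\<close>

definition selects :: "nat \<Rightarrow> nat \<Rightarrow> (nat \<Rightarrow> bool) \<Rightarrow> bool" where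
  "selects n j w \<longleftrightarrow> card (gt_necklaces n n w) < j \<and> j \<le> card (ge_necklaces n n w)"

lemma lgt_total: "lgt n x y \<or> lgt n y x \<or> (\<forall>s<n. x s = y s)"
proof (induction n)
  case (Suc n)
  then show ?case unfolding lgt_def by (auto simp: less_Suc_eq)
qed simp

lemma lge_lgt_trans:
  assumes "lge n x y" "lgt n y z" shows "lgt n x z"
proof (cases "\<forall>s<n. x s = y s")
  case True
  then show ?thesis using assms(2) unfolding lgt_def by (auto 0 3)
next
  case False
  then obtain i where i: "i < n" "\<not> y i" "x i" "\<forall>s<i. x s = y s" using assms(1) by (auto simp: lge_def lgt_def)
  obtain k where k: "k < n" "\<not> z k" "y k" "\<forall>s<k. y s = z s" using assms(2) by (auto simp: lgt_def)
  have "i \<noteq> k" using i k by auto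
  then consider "i < k" | "k < i" by linarith
  then show ?thesis
  proof cases
    case 1
    then show ?thesis using i k unfolding lgt_def by (intro exI[of _ i]) auto
  next
    case 2
    then show ?thesis using i k unfolding lgt_def by (intro exI[of _ k]) auto
  qed
qed

lemma ge_subset_gt: "lgt n v w \<Longrightarrow> ge_necklaces n n v \<subseteq> gt_necklaces n n w"
  unfolding ge_necklaces_def gt_necklaces_def using lge_lgt_trans by blast

lemma lgt_irrefl: "(\<And>s. s < n \<Longrightarrow> x s = w s) \<Longrightarrow> \<not> lgt n x w"
  by (auto simp: lgt_def)

text \<open>A class in the weak set but not in the strict one has a rotation equal to
  \<open>w\<close>, so it is the class of \<open>w\<close>. The two counts differ by at most one,
  which leaves a single possible \<open>j\<close>.\<close>

lemma selects_class:
  assumes s: "selects n j w"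
  shows "necklace_rel n `` {map w [0..<n]} \<in> ge_necklaces n n w" "j = card (ge_necklaces n n w)"
proof -
  let ?c = "necklace_rel n `` {map w [0..<n]}"
  have sub: "ge_necklaces n n w - gt_necklaces n n w \<subseteq> {?c}"
  proof
    fix c assume c: "c \<in> ge_necklaces n n w - gt_necklaces n n w"
    then have cn: "c \<in> necklaces n" by (simp add: ge_necklaces_def)
    obtain x where x: "x \<in> c" "\<not> lgt n ((!) x) w" using c by (auto simp: ge_necklaces_def gt_necklaces_def)
    then have eq: "\<forall>s<n. x ! s = w s" using c by (auto simp: ge_necklaces_def lge_def)
    have l: "length x = n" "c = {rotate k x | k. True}" using necklace_eq_class[OF cn x(1)] .
    have "x = map w [0..<n]" by (rule nth_equalityI) (use l eq in auto)
    then show "c \<in> {?c}" using l necklace_class[OF l(1)] by simp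
  qed
  have fin: "finite (ge_necklaces n n w)" "finite (gt_necklaces n n w)"
    by (auto simp: ge_necklaces_def gt_necklaces_def)
  have gtge: "gt_necklaces n n w \<subseteq> ge_necklaces n n w"
    by (auto simp: ge_necklaces_def gt_necklaces_def lge_def)
  have lt: "card (gt_necklaces n n w) < card (ge_necklaces n n w)" using s by (simp add: selects_def)
  then have "ge_necklaces n n w - gt_necklaces n n w \<noteq> {}" using gtge by auto
  then have eq: "ge_necklaces n n w - gt_necklaces n n w = {?c}" using sub by blast
  then show "?c \<in> ge_necklaces n n w" by blast
  have "card (ge_necklaces n n w) = card (gt_necklaces n n w) + 1"
    using card_Diff_subset[OF fin(2) gtge] eq lt by simp
  then show "j = card (ge_necklaces n n w)" using s by (simp add: selects_def)
qed

lemma selects_word_unique: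
  assumes "selects n j v" "selects n j w" shows "map v [0..<n] = map w [0..<n]"
proof -
  have *: "\<not> lgt n v w" if "selects n j v" "selects n j w" for v w
  proof
    assume "lgt n v w"
    then have "card (ge_necklaces n n v) \<le> card (gt_necklaces n n w)"
      by (intro card_mono ge_subset_gt) (auto simp: gt_necklaces_def)
    then show False using that by (simp add: selects_def)
  qed
  then show ?thesis using assms lgt_total[of n v w] by (auto simp: map_eq_conv)
qed

text \<open>If the two words differed, the common class would consist of strings strictly above the
  smaller word, yet that word belongs to it.\<close>

lemma selects_index_unique:
  assumes v: "selects n j v" and w: "selects n k w"
    and eq: "necklace_rel n `` {map v [0..<n]} = necklace_rel n `` {map w [0..<n]}"
  shows "j = k"
proof -
  have mem: "map v [0..<n] \<in> necklace_rel n `` {map v [0..<n]}" for v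
    by (subst necklace_class) (auto intro!: exI[of _ 0])
  have *: "\<not> lgt n v w" if "selects n j v" "selects n k w"
    "necklace_rel n `` {map v [0..<n]} = necklace_rel n `` {map w [0..<n]}" for v w j k
  proof
    assume gt: "lgt n v w"
    have "necklace_rel n `` {map w [0..<n]} \<in> gt_necklaces n n w"
      using selects_class(1)[OF that(1)] ge_subset_gt[OF gt] that(3) by auto
    then have "lgt n ((!) (map w [0..<n])) w" using mem[of w] unfolding gt_necklaces_def by blast
    moreover have "\<not> lgt n ((!) (map w [0..<n])) w" by (rule lgt_irrefl) simp
    ultimately show False by simp
  qed
  have e: "v s = w s" if "s < n" for s
    using lgt_total[of n v w] *[OF v w eq] *[OF w v eq[symmetric]] that by blast
  have "lgt n x v = lgt n x w" for x by (rule lgt_cong) (use e in auto)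
  moreover from this have "lge n x v = lge n x w" for x using e by (auto simp: lge_def)
  ultimately have "ge_necklaces n n v = ge_necklaces n n w" by (simp add: ge_necklaces_def)
  then show ?thesis using selects_class(2)[OF v] selects_class(2)[OF w] by simp
qed

text \<open>The assumption will be supplied by the runs of the program. Surjectivity follows from
  injectivity because both sides have the same size.\<close>

lemma selects_bij:
  assumes ex: "\<And>j. j \<in> {1..card (necklaces n)} \<Longrightarrow> \<exists>w. selects n j w"
  shows "\<exists>idx. bij_betw idx {1..card (necklaces n)} (necklaces n) \<and>
    (\<forall>j w. selects n j w \<longrightarrow> map w [0..<n] \<in> idx j)"
proof -
  define idx where "idx = (\<lambda>j. necklace_rel n `` {map (SOME w. selects n j w) [0..<n]})"
  have some: "selects n j (SOME w. selects n j w)" if "j \<in> {1..card (necklaces n)}" for j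
    using ex[OF that] by (rule someI_ex)
  have inj: "inj_on idx {1..card (necklaces n)}"
    unfolding idx_def by (rule inj_onI) (use some selects_index_unique in blast)
  have sub: "idx ` {1..card (necklaces n)} \<subseteq> necklaces n"
    using selects_class(1)[OF some] unfolding idx_def ge_necklaces_def by blast
  have "idx ` {1..card (necklaces n)} = necklaces n"
    by (rule card_subset_eq) (use sub card_image[OF inj] in auto)
  moreover have "map w [0..<n] \<in> idx j" if w: "selects n j w" for j w
  proof -
    have "selects n j (SOME w. selects n j w)" using someI[of "selects n j", OF w] .
    then have "map w [0..<n] = map (SOME w. selects n j w) [0..<n]" using selects_word_unique w by blast
    then show ?thesis unfolding idx_def by (subst necklace_class) (auto intro!: exI[of _ 0])
  qed
  ultimately show ?thesis using inj unfolding bij_betw_def by blast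
qed

section \<open>Extracting the count from an integer quotient\<close>

text \<open>There are no carries: the coefficients together stay below \<open>X\<close>, so all
  terms of exponent below \<open>N\<close> sum to less than \<open>X ^ N\<close>.\<close>

lemma digit_sum:
  fixes c e :: "'a \<Rightarrow> nat"
  assumes fin: "finite A" and lt: "sum c A < X"
  shows "(\<Sum>a\<in>A. c a * X ^ e a) div X ^ N mod X = sum c {a \<in> A. e a = N}"
proof -
  define lo where "lo = (\<Sum>a\<in>{a \<in> A. e a < N}. c a * X ^ e a)"
  define hi where "hi = (\<Sum>a\<in>{a \<in> A. N < e a}. c a * X ^ e a)"
  define mid where "mid = sum c {a \<in> A. e a = N}"
  have X: "0 < X" using lt by simp
  have A: "A = ({a \<in> A. e a < N} \<union> {a \<in> A. e a = N}) \<union> {a \<in> A. N < e a}" by auto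
  have "(\<Sum>a\<in>A. c a * X ^ e a) =
      (\<Sum>a\<in>{a \<in> A. e a < N} \<union> {a \<in> A. e a = N}. c a * X ^ e a) + hi"
    unfolding hi_def using fin by (subst A, intro sum.union_disjoint) auto
  also have "(\<Sum>a\<in>{a \<in> A. e a < N} \<union> {a \<in> A. e a = N}. c a * X ^ e a) =
      lo + (\<Sum>a\<in>{a \<in> A. e a = N}. c a * X ^ e a)"
    unfolding lo_def using fin by (intro sum.union_disjoint) auto
  also have "(\<Sum>a\<in>{a \<in> A. e a = N}. c a * X ^ e a) = mid * X ^ N"
    unfolding mid_def sum_distrib_right by (rule sum.cong) auto
  finally have eq: "(\<Sum>a\<in>A. c a * X ^ e a) = lo + mid * X ^ N + hi" .
  have "X * X ^ N dvd hi" unfolding hi_def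
  proof (rule dvd_sum)
    fix a assume "a \<in> {a \<in> A. N < e a}"
    then have "X ^ Suc N dvd X ^ e a" by (intro le_imp_power_dvd) simp
    then show "X * X ^ N dvd c a * X ^ e a" by simp
  qed
  then obtain h where h: "hi = X * X ^ N * h" by blast
  have lo: "lo < X ^ N"
  proof (cases N)
    case 0 then show ?thesis by (simp add: lo_def)
  next
    case (Suc M)
    have "lo \<le> (\<Sum>a\<in>{a \<in> A. e a < N}. c a * X ^ M)" unfolding lo_def
    proof (rule sum_mono)
      fix a assume "a \<in> {a \<in> A. e a < N}"
      then have "X ^ e a \<le> X ^ M" using X Suc by (intro power_increasing) auto
      then show "c a * X ^ e a \<le> c a * X ^ M" by simp
    qed
    also have "\<dots> \<le> sum c A * X ^ M"
      unfolding sum_distrib_right[symmetric] using fin by (intro mult_right_mono sum_mono2) auto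
    also have "\<dots> < X * X ^ M" using lt X by simp
    finally show ?thesis by (simp add: Suc)
  qed
  have mid: "mid < X" unfolding mid_def
    by (rule order.strict_trans1[OF sum_mono2 lt]) (use fin in auto)
  have "lo + mid * X ^ N + hi = (mid + X * h) * X ^ N + lo" by (simp add: h algebra_simps)
  then have "(lo + mid * X ^ N + hi) div X ^ N = ((mid + X * h) * X ^ N + lo) div X ^ N" by (simp only:)
  also have "\<dots> = mid + X * h" using lo X by simp
  finally have "(lo + mid * X ^ N + hi) div X ^ N = mid + X * h" .
  then show ?thesis using mid by (simp add: eq mid_def)
qed

text \<open>\<open>X ^ n\<close> times \<open>P(1/X)\<close>, where \<open>P(z)\<close> is the sum
  of \<open>z ^ (i + 1)\<close> over the tiles; the factor clears the denominators.\<close>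

definition block_poly :: "nat \<Rightarrow> nat \<Rightarrow> (nat \<Rightarrow> bool) \<Rightarrow> nat \<Rightarrow> nat" where
  "block_poly X n w L = (\<Sum>i\<in>zeros w L. X ^ (n - 1 - i))"

text \<open>\<open>X ^ n\<close> times \<open>z P'(z)\<close> at \<open>z = 1/X\<close>. The series
  \<open>z P'(z) / (1 - P(z))\<close> counts tilings of a circle with a marked position.\<close>

definition weighted_poly :: "nat \<Rightarrow> nat \<Rightarrow> (nat \<Rightarrow> bool) \<Rightarrow> nat \<Rightarrow> nat" where
  "weighted_poly X n w L = (\<Sum>i\<in>zeros w L. Suc i * X ^ (n - 1 - i))"

lemma zeros_less: "i \<in> zeros w L \<Longrightarrow> L \<le> n \<Longrightarrow> i < n"
  by (simp add: zeros_def)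

lemma card_zeros: "card (zeros w L) \<le> L"
  using card_mono[of "{..<L}" "zeros w L"] by (force simp: zeros_def)

lemma block_poly_le:
  assumes "L \<le> n" "0 < X" shows "block_poly X n w L \<le> n * X ^ (n - 1)"
proof -
  have "block_poly X n w L \<le> of_nat (card (zeros w L)) * X ^ (n - 1)" unfolding block_poly_def
    by (rule sum_bounded_above) (use assms in \<open>auto intro!: power_increasing\<close>)
  also have "\<dots> \<le> n * X ^ (n - 1)" using card_zeros[of w L] assms by (intro mult_right_mono) auto
  finally show ?thesis .
qed

lemma weighted_poly_le:
  assumes "L \<le> n" "0 < X" shows "weighted_poly X n w L \<le> n * n * X ^ (n - 1)"
proof -
  have "weighted_poly X n w L \<le> of_nat (card (zeros w L)) * (n * X ^ (n - 1))" unfolding weighted_poly_def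
  proof (rule sum_bounded_above)
    fix i assume "i \<in> zeros w L"
    then have "Suc i \<le> n" using assms zeros_less by (meson Suc_leI)
    then show "Suc i * X ^ (n - 1 - i) \<le> n * X ^ (n - 1)"
      using assms by (intro mult_mono power_increasing) auto
  qed
  also have "\<dots> \<le> n * (n * X ^ (n - 1))" using card_zeros[of w L] assms by (intro mult_right_mono) auto
  finally show ?thesis by (simp add: mult.assoc)
qed

text \<open>The generating function of the tilings is \<open>1 / (1 - \<Sum>z\<^sup>i\<^sup>+\<^sup>1)\<close>, the sum ranging over the tiles;
  evaluated at \<open>z = 1/X\<close> for large \<open>X\<close>, its coefficients are the base-\<open>X\<close> digits of one quotient.\<close>

lemma tiling_quotient:
  assumes n: "0 < n" and L: "L \<le> n" and X: "n * (n + 1) * 2 ^ n + n < X"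
  shows "X ^ n * X ^ n div (X ^ n - block_poly X n w L) = (\<Sum>k\<le>n. tcount w L k * X ^ (n - k))"
proof -
  let ?T = "tcount w L" and ?Z = "zeros w L"
  let ?S = "block_poly X n w L" and ?U = "\<Sum>k\<le>n. tcount w L k * X ^ (n - k)"
  let ?t = "\<lambda>(k, i). ?T k * X ^ (2 * n - Suc (i + k))"
  let ?P = "{..n} \<times> ?Z"
  \<comment> \<open>In the product of quotient and tile polynomial, \<open>?lo\<close> collects
    total lengths up to \<open>n\<close>, where the recurrence for \<open>tcount\<close> makes
    everything cancel. \<open>?hi\<close> is the part cut off by truncating the series; it becomes
    the remainder of the division.\<close>
  let ?lo = "{(k, i) \<in> ?P. i + k < n}" and ?hi = "{(k, i) \<in> ?P. \<not> i + k < n}"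
  have X0: "0 < X" using X by simp
  have finP: "finite ?P" by simp
  have US: "?U * ?S = sum ?t ?P"
  proof -
    have "?U * ?S = (\<Sum>(k, i)\<in>?P. ?T k * X ^ (n - k) * X ^ (n - 1 - i))"
      unfolding block_poly_def sum_product sum.cartesian_product ..
    also have "\<dots> = sum ?t ?P"
    proof -
      have "?T k * X ^ (n - k) * X ^ (n - 1 - i) = ?T k * X ^ (2 * n - Suc (i + k))"
        if "k \<le> n" "i \<in> ?Z" for k i
      proof -
        have "2 * n - Suc (i + k) = (n - k) + (n - 1 - i)" using that zeros_less[OF that(2) L] by simp
        then show ?thesis by (simp add: power_add)
      qed
      then show ?thesis by (intro sum.cong[OF refl]) auto
    qed
    finally show ?thesis .
  qed
  have split: "sum ?t ?P = sum ?t ?lo + sum ?t ?hi"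
  proof -
    have P: "?P = ?lo \<union> ?hi" by auto
    have "finite ?lo" "finite ?hi" by (rule finite_subset[OF _ finP], blast)+
    then show ?thesis by (subst P, intro sum.union_disjoint) auto
  qed
  have lo: "sum ?t ?lo = (\<Sum>m=1..n. ?T m * X ^ (2 * n - m))"
  proof -
    have "(\<Sum>m=1..n. ?T m * X ^ (2 * n - m)) =
        (\<Sum>m=1..n. \<Sum>i\<in>{i\<in>?Z. i < m}. ?T (m - 1 - i) * X ^ (2 * n - m))"
      by (rule sum.cong[OF refl]) (simp add: tcount_rec sum_distrib_right)
    also have "\<dots> = (\<Sum>(m, i)\<in>(SIGMA m:{1..n}. {i\<in>?Z. i < m}). ?T (m - 1 - i) * X ^ (2 * n - m))"
      by (rule sum.Sigma) auto
    also have "\<dots> = sum ?t ?lo"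
      by (rule sum.reindex_bij_witness[where j = "\<lambda>(m, i). (m - 1 - i, i)" and i = "\<lambda>(k, i). (Suc (i + k), i)"])
        auto
    finally show ?thesis by simp
  qed
  have UX: "?U * X ^ n = X ^ n * X ^ n + (\<Sum>m=1..n. ?T m * X ^ (2 * n - m))"
  proof -
    have "?U * X ^ n = (\<Sum>k\<le>n. ?T k * X ^ (2 * n - k))" unfolding sum_distrib_right
    proof (rule sum.cong[OF refl])
      fix k assume "k \<in> {..n}"
      then have "2 * n - k = (n - k) + n" by simp
      then show "?T k * X ^ (n - k) * X ^ n = ?T k * X ^ (2 * n - k)" by (simp add: power_add)
    qed
    also have "\<dots> = X ^ (2 * n) + (\<Sum>k=1..n. ?T k * X ^ (2 * n - k))"
    proof -
      have "{..n} = insert 0 {1..n}" by auto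
      then show ?thesis by simp
    qed
    also have "X ^ (2 * n) = X ^ n * X ^ n" by (simp add: mult_2 power_add)
    finally show ?thesis .
  qed
  have Xn: "X * X ^ (n - 1) = X ^ n" using n by (simp flip: power_Suc)
  have "sum ?t ?hi \<le> of_nat (card ?hi) * (2 ^ n * X ^ (n - 1))"
  proof (rule sum_bounded_above)
    fix a assume "a \<in> ?hi"
    then obtain k i where a: "a = (k, i)" and *: "k \<in> {..n}" "i \<in> ?Z" "\<not> i + k < n" by auto
    have "?T k \<le> 2 ^ n" using * by (intro order.trans[OF tcount_le] power_increasing) auto
    then have "?T k * X ^ (2 * n - Suc (i + k)) \<le> 2 ^ n * X ^ (n - 1)"
      using X0 * by (intro mult_mono power_increasing) auto
    then show "?t a \<le> 2 ^ n * X ^ (n - 1)" unfolding a by (simp only: prod.case)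
  qed
  also have "\<dots> \<le> (n * (n + 1)) * (2 ^ n * X ^ (n - 1))"
  proof -
    have "card ?hi \<le> card ?P" by (rule card_mono[OF finP]) auto
    also have "\<dots> \<le> (n + 1) * n" unfolding card_cartesian_product
      using card_zeros[of w L] L by (intro mult_le_mono) auto
    also have "\<dots> = n * (n + 1)" by (rule mult.commute)
    finally show ?thesis by (intro mult_right_mono) simp_all
  qed
  finally have hi: "sum ?t ?hi \<le> n * (n + 1) * 2 ^ n * X ^ (n - 1)" by (simp add: mult.assoc)
  have "?S + sum ?t ?hi \<le> (n * (n + 1) * 2 ^ n + n) * X ^ (n - 1)"
    using hi block_poly_le[OF L X0, of w] unfolding distrib_right by linarith
  also have "\<dots> < X * X ^ (n - 1)" using X X0 by simp
  finally have small: "?S + sum ?t ?hi < X ^ n" unfolding Xn .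
  have "?U * (X ^ n - ?S) + sum ?t ?hi = X ^ n * X ^ n"
  proof -
    have "?U * (X ^ n - ?S) + ?U * ?S = ?U * X ^ n"
      using small by (simp add: distrib_left[symmetric])
    then show ?thesis unfolding UX US split lo by simp
  qed
  then have "X ^ n * X ^ n div (X ^ n - ?S) = (?U * (X ^ n - ?S) + sum ?t ?hi) div (X ^ n - ?S)" by simp
  also have "\<dots> = ?U" using small by (subst div_mult_self3) auto
  finally show ?thesis .
qed

text \<open>The factor \<open>X ^ gcd n q\<close> moves the coefficient of
  \<open>z ^ gcd n q\<close> to digit \<open>2 * n\<close>, for all \<open>q\<close> at once, so one
  digit holds the whole Burnside sum.\<close>

lemma ccount_digit:
  assumes n: "0 < n" and L: "L \<le> n" and X: "X = 64 ^ n"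
  shows "((X ^ n * X ^ n div (X ^ n - block_poly X n w L)) * (weighted_poly X n w L * (\<Sum>q=1..n. X ^ gcd n q)))
      div (X ^ n * X ^ n) mod X = (\<Sum>q=1..n. ccount w L (gcd n q))"
proof -
  let ?T = "tcount w L" and ?Z = "zeros w L"
  let ?A = "{..n} \<times> ?Z \<times> {1..n}"
  let ?c = "\<lambda>(k, i, q :: nat). ?T k * Suc i"
  let ?e = "\<lambda>(k, i, q). (n - k) + ((n - 1 - i) + gcd n q)"
  have n2: "n + 1 \<le> 2 ^ n" using less_exp[of n] by (simp add: Suc_le_eq)
  \<comment> \<open>The first bound is on the sum of all coefficients: five factors of at most
    \<open>2 ^ n\<close> give \<open>32 ^ n\<close>. The second is the hypothesis of
    \<open>tiling_quotient\<close>. Base 64 exceeds both 32 and 16.\<close>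
  have big: "n * n * (n + 1) * n * 2 ^ n < X" "n * (n + 1) * 2 ^ n + n < X"
  proof -
    have "n * n * (n + 1) * n * 2 ^ n \<le> 2 ^ n * 2 ^ n * 2 ^ n * 2 ^ n * (2 ^ n :: nat)"
      using n2 by (intro mult_mono) auto
    also have "\<dots> = 32 ^ n" by (simp add: power_mult_distrib[symmetric])
    also have "\<dots> < X" unfolding X using n by (intro power_strict_mono) auto
    finally show "n * n * (n + 1) * n * 2 ^ n < X" .
    have "n * (n + 1) * 2 ^ n + n \<le> n * (n + 1) * 2 ^ n + n * (n + 1) * 2 ^ n"
      using mult_le_mono[of n "n * (n + 1)" 1 "2 ^ n"] by simp
    also have "\<dots> = n * (n + 1) * (2 * 2 ^ n)" by simp
    also have "\<dots> \<le> 2 ^ n * 2 ^ n * (2 ^ n * (2 ^ n :: nat))"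
      using n2 n self_le_power[of "2::nat" n] by (intro mult_mono) auto
    also have "\<dots> = 16 ^ n" by (simp add: power_mult_distrib[symmetric])
    also have "\<dots> < X" unfolding X using n by (intro power_strict_mono) auto
    finally show "n * (n + 1) * 2 ^ n + n < X" .
  qed
  have prod: "(\<Sum>k\<le>n. ?T k * X ^ (n - k)) * (weighted_poly X n w L * (\<Sum>q=1..n. X ^ gcd n q)) =
      (\<Sum>a\<in>?A. ?c a * X ^ ?e a)"
    unfolding weighted_poly_def sum_product sum.cartesian_product
    by (rule sum.cong[OF refl], clarify) (simp only: prod.case power_add ac_simps)
  have "sum ?c ?A \<le> of_nat (card ?A) * (2 ^ n * n)"
  proof (rule sum_bounded_above)
    fix a assume "a \<in> ?A"
    then obtain k i q where a: "a = (k, i, q)" and *: "k \<in> {..n}" "i \<in> ?Z" "q \<in> {1..n}" by auto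
    have "?T k \<le> 2 ^ n" using * by (intro order.trans[OF tcount_le] power_increasing) auto
    moreover have "Suc i \<le> n" using zeros_less[OF *(2) L] by simp
    ultimately have "?T k * Suc i \<le> 2 ^ n * n" by (rule mult_le_mono)
    then show "?c a \<le> 2 ^ n * n" unfolding a by (simp only: prod.case)
  qed
  also have "\<dots> \<le> ((n + 1) * (n * n)) * (2 ^ n * n)"
  proof -
    have "card ?A \<le> (n + 1) * (n * n)" unfolding card_cartesian_product
      using card_zeros[of w L] L by (intro mult_le_mono) auto
    then show ?thesis by (intro mult_right_mono) simp_all
  qed
  also have "\<dots> = n * n * (n + 1) * n * 2 ^ n" by simp
  finally have "sum ?c ?A < X" using big(1) by linarith
  then have "(\<Sum>a\<in>?A. ?c a * X ^ ?e a) div X ^ (2 * n) mod X = sum ?c {a \<in> ?A. ?e a = 2 * n}"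
    by (intro digit_sum) auto
  \<comment> \<open>The exponent is \<open>2 * n\<close> exactly when
    \<open>gcd n q = i + k + 1\<close>, that is, when the marked tile and the rest fill one
    period.\<close>
  also have "\<dots> = (\<Sum>(q, i)\<in>(SIGMA q:{1..n}. {i\<in>?Z. i < gcd n q}). ?T (gcd n q - 1 - i) * Suc i)"
  proof (rule sum.reindex_bij_witness
      [where j = "\<lambda>(k, i, q). (q, i)" and i = "\<lambda>(q, i). (gcd n q - 1 - i, i, q)"])
    fix a assume "a \<in> {a \<in> ?A. ?e a = 2 * n}"
    then obtain k i q where a: "a = (k, i, q)" "k \<le> n" "i \<in> ?Z" "q \<in> {1..n}"
      "(n - k) + ((n - 1 - i) + gcd n q) = 2 * n" by auto
    have "i < n" using zeros_less[OF a(3) L] .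
    then have k: "gcd n q = Suc (i + k)" using a by simp
    show "(case case a of (k, i, q) \<Rightarrow> (q, i) of (q, i) \<Rightarrow> (gcd n q - 1 - i, i, q)) = a"
      "(case a of (k, i, q) \<Rightarrow> (q, i)) \<in> (SIGMA q:{1..n}. {i\<in>?Z. i < gcd n q})"
      "(case case a of (k, i, q) \<Rightarrow> (q, i) of (q, i) \<Rightarrow> ?T (gcd n q - 1 - i) * Suc i) = ?c a"
      using a k by auto
  next
    fix b assume "b \<in> (SIGMA q:{1..n}. {i\<in>?Z. i < gcd n q})"
    then obtain q i where b: "b = (q, i)" "q \<in> {1..n}" "i \<in> ?Z" "i < gcd n q" by auto
    have g: "gcd n q \<le> n" using n by (simp add: gcd_le1_nat)
    have "i < n" using zeros_less[OF b(3) L] .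
    then have e: "(n - (gcd n q - 1 - i)) + ((n - 1 - i) + gcd n q) = 2 * n" using b(4) g by linarith
    have k: "gcd n q - 1 - i \<in> {..n}" using g unfolding atMost_iff by linarith
    show "(case case b of (q, i) \<Rightarrow> (gcd n q - 1 - i, i, q) of (k, i, q) \<Rightarrow> (q, i)) = b"
      by (simp add: b(1))
    show "(case b of (q, i) \<Rightarrow> (gcd n q - 1 - i, i, q)) \<in> {a \<in> ?A. ?e a = 2 * n}"
      unfolding b(1) prod.case mem_Collect_eq using b(2,3) e k by blast
  qed
  also have "\<dots> = (\<Sum>q=1..n. ccount w L (gcd n q))"
    unfolding ccount_def by (subst sum.Sigma[symmetric]) (auto simp: mult.commute)
  finally show ?thesis
    unfolding tiling_quotient[OF n L big(2)] prod by (simp add: mult_2 power_add)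
qed

corollary necklace_count_formula:
  assumes "0 < n" "L \<le> n" "prenecklace w L" "X = 64 ^ n"
  shows "((X ^ n * X ^ n div (X ^ n - block_poly X n w L)) * (weighted_poly X n w L * (\<Sum>q=1..n. X ^ gcd n q)))
      div (X ^ n * X ^ n) mod X div n = card (gt_necklaces n L w)"
  using ccount_digit[OF assms(1,2,4), of w] card_gt_necklaces[OF assms(1-3)] assms(1) by (metis nonzero_mult_div_cancel_left less_irrefl)

section \<open>Running time\<close>

definition bounded :: "nat \<Rightarrow> state \<Rightarrow> bool" where
  "bounded V s \<longleftrightarrow> (\<forall>r. s r < 2 ^ V)"

lemma bitlen_le: "x < 2 ^ V \<Longrightarrow> bitlen x \<le> Suc V"
  unfolding bitlen_def by (simp add: Least_le)

lemma less_2_bitlen: "x < 2 ^ bitlen x"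
proof -
  have "x < 2 ^ (LEAST k. x < 2 ^ k)" using less_exp[of x] by (rule LeastI)
  also have "\<dots> < (2 :: nat) ^ bitlen x" unfolding bitlen_def by simp
  finally show ?thesis .
qed

text \<open>Cost in units of \<open>Suc V\<close>: reading a register counts one unit, and a
  constant counts its own length.\<close>

fun asz :: "aexp \<Rightarrow> nat" where
  "asz (Num c) = bitlen c"
| "asz (Var x) = 1"
| "asz (Plus a b) = asz a + asz b + 1"
| "asz (Minus a b) = asz a + asz b + 1"
| "asz (Mult a b) = asz a + asz b + 1"
| "asz (Div a b) = asz a + asz b + 1"
| "asz (Mod a b) = asz a + asz b + 1"

fun bsz :: "bexp \<Rightarrow> nat" where
  "bsz (Bc v) = 1"
| "bsz (Not b) = bsz b + 1"
| "bsz (And b1 b2) = bsz b1 + bsz b2 + 1"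
| "bsz (Less a b) = asz a + asz b + 1"
| "bsz (Eq a b) = asz a + asz b + 1"

lemma acost_le: "bounded V s \<Longrightarrow> acost a s \<le> asz a * Suc V"
proof (induction a)
  case (Var x)
  then show ?case using bitlen_le[of "s x" V] by (simp add: bounded_def)
qed (auto simp: algebra_simps)

lemma bcost_le: "bounded V s \<Longrightarrow> bcost b s \<le> bsz b * Suc V"
proof (induction b)
  case (Less a b)
  then show ?case using acost_le[of V s a] acost_le[of V s b] by (simp add: algebra_simps)
next
  case (Eq a b)
  then show ?case using acost_le[of V s a] acost_le[of V s b] by (simp add: algebra_simps)
qed (auto simp: algebra_simps)

text \<open>A timed total-correctness triple; \<open>N\<close> counts units of \<open>Suc V\<close>,
  the most that reading a register can cost. Only register contents are kept below
  \<open>2 ^ V\<close>: \<open>acost\<close> charges for the leaves of an expression, so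
  intermediate products may be larger.\<close>

definition runs :: "nat \<Rightarrow> com \<Rightarrow> state \<Rightarrow> nat \<Rightarrow> (state \<Rightarrow> bool) \<Rightarrow> bool" where
  "runs V c s N Q \<longleftrightarrow> (\<exists>t s'. big_step c s t s' \<and> t \<le> N * Suc V \<and> bounded V s' \<and> Q s')"

text \<open>For loop-free code only. Adding both branches avoids a maximum, and the value for
  \<open>While\<close> is arbitrary because \<open>wp\<close> rejects loops.\<close>

fun csz :: "com \<Rightarrow> nat" where
  "csz SKIP = 1"
| "csz (Assign x a) = asz a + 1"
| "csz (Seq c1 c2) = csz c1 + csz c2 + 1"
| "csz (If b c1 c2) = bsz b + (csz c1 + csz c2) + 1"
| "csz (While b c) = 0"

fun wp :: "nat \<Rightarrow> com \<Rightarrow> (state \<Rightarrow> bool) \<Rightarrow> state \<Rightarrow> bool" where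
  "wp V SKIP Q s = Q s"
| "wp V (Assign x a) Q s = (aval a s < 2 ^ V \<and> Q (s(x := aval a s)))"
| "wp V (Seq c1 c2) Q s = wp V c1 (wp V c2 Q) s"
| "wp V (If b c1 c2) Q s = ((bval b s \<longrightarrow> wp V c1 Q s) \<and> (\<not> bval b s \<longrightarrow> wp V c2 Q s))"
| "wp V (While b c) Q s = False"

lemma runs_Seq:
  assumes "runs V c1 s N1 Q1" "\<And>s1. bounded V s1 \<Longrightarrow> Q1 s1 \<Longrightarrow> runs V c2 s1 N2 Q"
  shows "runs V (Seq c1 c2) s (N1 + N2 + 1) Q"
proof -
  obtain t1 s1 where 1: "big_step c1 s t1 s1" "t1 \<le> N1 * Suc V" "bounded V s1" "Q1 s1"
    using assms(1) by (auto simp: runs_def)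
  obtain t2 s2 where 2: "big_step c2 s1 t2 s2" "t2 \<le> N2 * Suc V" "bounded V s2" "Q s2"
    using assms(2)[OF 1(3,4)] by (auto simp: runs_def)
  have "t1 + t2 + 1 \<le> (N1 + N2 + 1) * Suc V" using 1(2) 2(2) by (simp add: algebra_simps)
  then show ?thesis unfolding runs_def using big_step.Seq[OF 1(1) 2(1)] 2 by blast
qed

lemma runs_mono:
  assumes "runs V c s N Q" "N \<le> M" shows "runs V c s M Q"
proof -
  have "N * Suc V \<le> M * Suc V" using assms(2) by (rule mult_le_mono1)
  then show ?thesis using assms(1) unfolding runs_def by (meson order.trans)
qed

lemma runs_post:
  assumes "runs V c s N Q" "\<And>s'. bounded V s' \<Longrightarrow> Q s' \<Longrightarrow> Q' s'" shows "runs V c s N Q'"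
  using assms unfolding runs_def by blast

lemma runs_If:
  assumes "bounded V s" "bval b s \<Longrightarrow> runs V c1 s N Q" "\<not> bval b s \<Longrightarrow> runs V c2 s N Q"
  shows "runs V (If b c1 c2) s (bsz b + N + 1) Q"
proof -
  have b: "bcost b s \<le> bsz b * Suc V" using assms(1) by (rule bcost_le)
  have *: "bcost b s + t + 1 \<le> (bsz b + N + 1) * Suc V" if "t \<le> N * Suc V" for t
    using b that by (simp add: algebra_simps)
  show ?thesis
  proof (cases "bval b s")
    case True
    then obtain t s' where "big_step c1 s t s'" "t \<le> N * Suc V" "bounded V s'" "Q s'"
      using assms(2) by (auto simp: runs_def)
    then show ?thesis unfolding runs_def using big_step.IfT[OF True] * by blast
  next
    case False
    then obtain t s' where "big_step c2 s t s'" "t \<le> N * Suc V" "bounded V s'" "Q s'"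
      using assms(3) by (auto simp: runs_def)
    then show ?thesis unfolding runs_def using big_step.IfF[OF False] * by blast
  qed
qed

lemma wp_runs: "bounded V s \<Longrightarrow> wp V c Q s \<Longrightarrow> runs V c s (csz c) Q"
proof (induction c arbitrary: s Q)
  case SKIP
  have "1 \<le> csz SKIP * Suc V" by simp
  then show ?case unfolding runs_def using big_step.Skip[of s] SKIP by (metis wp.simps(1))
next
  case (Assign x a)
  have "acost a s + 1 \<le> (asz a + 1) * Suc V" using acost_le[OF Assign(1), of a] by (simp add: algebra_simps)
  moreover have "bounded V (s(x := aval a s))" using Assign by (simp add: bounded_def)
  ultimately show ?case unfolding runs_def csz.simps
    using Assign(2) big_step.Assign[of x a s] by (metis wp.simps(2))
next
  case (Seq c1 c2)
  have "runs V c1 s (csz c1) (wp V c2 Q)" by (rule Seq.IH(1)[OF Seq.prems(1)]) (use Seq.prems(2) in simp)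
  then show ?case unfolding csz.simps by (rule runs_Seq) (rule Seq.IH(2))
next
  case (If b c1 c2)
  have "runs V c1 s (csz c1 + csz c2) Q" if "bval b s"
    by (rule runs_mono[OF If.IH(1)[OF If.prems(1)]]) (use that If.prems(2) in simp_all)
  moreover have "runs V c2 s (csz c1 + csz c2) Q" if "\<not> bval b s"
    by (rule runs_mono[OF If.IH(2)[OF If.prems(1)]]) (use that If.prems(2) in simp_all)
  ultimately show ?case unfolding csz.simps by (rule runs_If[OF If.prems(1)])
qed simp

text \<open>The index of \<open>Inv\<close> is at once the variant that ensures termination and the
  bound on the number of iterations.\<close>

lemma runs_While:
  fixes Inv :: "nat \<Rightarrow> state \<Rightarrow> bool"
  assumes body: "\<And>k s. bounded V s \<Longrightarrow> Inv k s \<Longrightarrow> bval b s \<Longrightarrow> runs V c s N (\<lambda>s'. \<exists>k'<k. Inv k' s')"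
  shows "bounded V s \<Longrightarrow> Inv k s \<Longrightarrow>
    runs V (While b c) s (k * (N + bsz b + 1) + (bsz b + 1)) (\<lambda>s'. (\<exists>k'. Inv k' s') \<and> \<not> bval b s')"
proof (induction k arbitrary: s rule: less_induct)
  case (less k)
  have b: "bcost b s \<le> bsz b * Suc V" using less(2) by (rule bcost_le)
  show ?case
  proof (cases "bval b s")
    case False
    have "bcost b s + 1 \<le> (bsz b + 1) * Suc V" using b by (simp add: algebra_simps)
    also have "\<dots> \<le> (k * (N + bsz b + 1) + (bsz b + 1)) * Suc V" by (intro mult_le_mono1) simp
    finally show ?thesis unfolding runs_def using big_step.WhileF[OF False] False less(2,3) by blast
  next
    case True
    obtain t1 s1 k' where 1: "big_step c s t1 s1" "t1 \<le> N * Suc V" "bounded V s1" "k' < k" "Inv k' s1"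
      using body[OF less(2,3) True] by (auto simp: runs_def)
    obtain t2 s2 where 2: "big_step (While b c) s1 t2 s2"
      "t2 \<le> (k' * (N + bsz b + 1) + (bsz b + 1)) * Suc V" "bounded V s2" "\<exists>k'. Inv k' s2" "\<not> bval b s2"
      using less(1)[OF 1(4,3,5)] by (auto simp: runs_def)
    have "bcost b s + t1 + t2 + 1 \<le> bsz b * Suc V + N * Suc V + (k' * (N + bsz b + 1) + (bsz b + 1)) * Suc V + Suc V"
      using b 1(2) 2(2) by simp
    also have "\<dots> = (Suc k' * (N + bsz b + 1) + (bsz b + 1)) * Suc V" by (simp add: algebra_simps)
    also have "\<dots> \<le> (k * (N + bsz b + 1) + (bsz b + 1)) * Suc V"
      using 1(4) by (intro mult_le_mono1 add_le_mono) auto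
    finally show ?thesis unfolding runs_def using big_step.WhileT[OF True 1(1) 2(1)] 2(3-5) by blast
  qed
qed

definition for_n :: "com \<Rightarrow> com" where
  "for_n c = Seq (Assign 6 (Num 0)) (While (Less (Var 6) (Var 0)) (Seq c (Assign 6 (Plus (Var 6) (Num 1)))))"

definition for_n_overhead :: nat where
  "for_n_overhead = csz (Assign 6 (Plus (Var 6) (Num 1))) + bsz (Less (Var 6) (Var 0)) + csz (Assign 6 (Num 0)) + 3"

text \<open>The body leaves register 6 alone and the increment comes after it, hence the invariant
  for \<open>Suc l\<close> is demanded of the updated state.\<close>

lemma runs_for_n:
  assumes V: "n < 2 ^ V" and s: "bounded V s" "s 0 = n" "I 0 (s(6 := 0))"
    and I: "\<And>l s. I l s \<Longrightarrow> s 0 = n \<and> s 6 = l"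
    and body: "\<And>l s. bounded V s \<Longrightarrow> l < n \<Longrightarrow> I l s \<Longrightarrow>
      runs V c s N (\<lambda>s'. s' 6 = l \<and> I (Suc l) (s'(6 := Suc l)))"
  shows "runs V (for_n c) s (n * (N + for_n_overhead) + for_n_overhead) (I n)"
proof -
  let ?inc = "Assign 6 (Plus (Var 6) (Num 1))" and ?b = "Less (Var 6) (Var 0)"
  let ?Inv = "\<lambda>k s. k \<le> n \<and> I (n - k) s"
  have V0: "0 < (2 :: nat) ^ V" by simp
  have init: "runs V (Assign 6 (Num 0)) s (csz (Assign 6 (Num 0))) (?Inv n)"
    by (rule wp_runs[OF s(1)]) (simp add: s(3) V0)
  have step: "runs V (Seq c ?inc) s (N + csz ?inc + 1) (\<lambda>s'. \<exists>k'<k. ?Inv k' s')"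
    if bs: "bounded V s" and inv: "?Inv k s" and b: "bval ?b s" for k s
  proof -
    have k: "0 < k" "n - k < n" using inv b I[of "n - k" s] by auto
    then have k1: "Suc (n - k) = n - (k - 1)" using inv by auto
    have c: "runs V c s N (\<lambda>s'. s' 6 = n - k \<and> I (Suc (n - k)) (s'(6 := Suc (n - k))))"
      by (rule body[OF bs k(2)]) (use inv in simp)
    show ?thesis
    proof (rule runs_Seq[OF c])
      fix s1 assume s1: "bounded V s1" "s1 6 = n - k \<and> I (Suc (n - k)) (s1(6 := Suc (n - k)))"
      show "runs V ?inc s1 (csz ?inc) (\<lambda>s'. \<exists>k'<k. ?Inv k' s')"
      proof (rule wp_runs[OF s1(1)])
        have "Suc (n - k) < 2 ^ V" using V k(2) by simp
        moreover have "\<exists>k'<k. ?Inv k' (s1(6 := Suc (n - k)))"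
        proof (intro exI conjI)
          show "k - 1 < k" using k by simp
          show "k - 1 \<le> n" using inv by linarith
          show "I (n - (k - 1)) (s1(6 := Suc (n - k)))" using s1(2) unfolding k1 by blast
        qed
        ultimately show "wp V ?inc (\<lambda>s'. \<exists>k'<k. ?Inv k' s') s1" using s1(2) by simp
      qed
    qed
  qed
  have loop: "runs V (While ?b (Seq c ?inc)) s1 (n * (N + csz ?inc + 1 + bsz ?b + 1) + (bsz ?b + 1)) (I n)"
    if "bounded V s1" "?Inv n s1" for s1
  proof -
    have "runs V (While ?b (Seq c ?inc)) s1 (n * (N + csz ?inc + 1 + bsz ?b + 1) + (bsz ?b + 1))
        (\<lambda>s'. (\<exists>k'. ?Inv k' s') \<and> \<not> bval ?b s')"
    proof (rule runs_While[where Inv = ?Inv])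
      show "bounded V s1" "?Inv n s1" by (fact that)+
    qed (rule step)
    then show ?thesis
    proof (rule runs_post)
      fix s' assume exit: "(\<exists>k'. ?Inv k' s') \<and> \<not> bval ?b s'"
      obtain k' where k': "?Inv k' s'" "\<not> bval ?b s'" using exit by blast
      then have "n - k' = n" using I[of "n - k'" s'] by simp
      then show "I n s'" using k' by simp
    qed
  qed
  have "runs V (for_n c) s (csz (Assign 6 (Num 0)) + (n * (N + csz ?inc + 1 + bsz ?b + 1) + (bsz ?b + 1)) + 1) (I n)"
    unfolding for_n_def by (rule runs_Seq[OF init loop])
  moreover have "n * (N + csz ?inc + 1 + bsz ?b + 1) \<le> n * (N + for_n_overhead)"
    unfolding for_n_overhead_def by (intro mult_le_mono2) simp
  moreover have "csz (Assign 6 (Num 0)) + (bsz ?b + 1) + 1 \<le> for_n_overhead"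
    unfolding for_n_overhead_def by simp
  ultimately show ?thesis by (elim runs_mono) linarith
qed

section \<open>The search invariant\<close>

text \<open>The first character is the lowest bit, as in \<open>decode_string\<close>. All bits
  beyond the prefix read as 0, so appending a 0 leaves the number unchanged and \<open>p\<close>
  also codes the candidate \<open>w 0\<close>.\<close>

definition word :: "nat \<Rightarrow> nat \<Rightarrow> bool" where
  "word p i = odd (p div 2 ^ i)"

lemma word_ge: "p < 2 ^ l \<Longrightarrow> l \<le> i \<Longrightarrow> \<not> word p i"
proof -
  assume "p < 2 ^ l" "l \<le> i"
  then have "p < 2 ^ i" by (meson order.strict_trans2 power_increasing one_le_numeral)
  then show "\<not> word p i" by (simp add: word_def)
qed

lemma word_add: "p < 2 ^ l \<Longrightarrow> word (p + 2 ^ l) = (word p)(l := True)"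
proof
  fix i assume p: "p < 2 ^ l"
  consider "i < l" | "i = l" | "l < i" by linarith
  then show "word (p + 2 ^ l) i = ((word p)(l := True)) i"
  proof cases
    case 1
    then have e: "(2 :: nat) ^ l = 2 ^ i * 2 ^ (l - i)" by (simp flip: power_add)
    have "(p + 2 ^ l) div 2 ^ i = p div 2 ^ i + 2 ^ (l - i)" unfolding e by simp
    then show ?thesis using 1 by (simp add: word_def)
  next
    case 2
    have "(p + 2 ^ l) div 2 ^ l = p div 2 ^ l + 1" by (rule div_add_self2) simp
    then show ?thesis using 2 p by (simp add: word_def)
  next
    case 3
    have "p + 2 ^ l < 2 ^ Suc l" using p by simp
    then have "\<not> word (p + 2 ^ l) i" by (rule word_ge) (use 3 in simp)
    moreover have "\<not> word p i" by (rule word_ge[OF p]) (use 3 in simp)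
    ultimately show ?thesis using 3 by simp
  qed
qed

lemma zeros_Suc_False: "\<not> w l \<Longrightarrow> zeros w (Suc l) = insert l (zeros w l)"
  by (auto simp: zeros_def)

lemma zeros_Suc_True: "zeros (w(l := True)) (Suc l) = zeros w l"
  by (auto simp: zeros_def)

lemma block_poly_Suc_False: "\<not> w l \<Longrightarrow> block_poly X n w (Suc l) = block_poly X n w l + X ^ (n - 1 - l)"
  by (simp add: block_poly_def zeros_Suc_False) (simp add: zeros_def)

lemma weighted_poly_Suc_False:
  "\<not> w l \<Longrightarrow> weighted_poly X n w (Suc l) = weighted_poly X n w l + (l + 1) * X ^ (n - 1 - l)"
  by (simp add: weighted_poly_def zeros_Suc_False) (simp add: zeros_def)

lemma poly_Suc_True:
  "block_poly X n (w(l := True)) (Suc l) = block_poly X n w l"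
  "weighted_poly X n (w(l := True)) (Suc l) = weighted_poly X n w l"
  by (simp_all add: block_poly_def weighted_poly_def zeros_Suc_True)

text \<open>The exponent of \<open>z\<close> is \<open>l + 1 - \<pi>\<close> and not
  \<open>l - \<pi>\<close>, which would be truncated for the empty prefix (\<open>l = 0\<close>,
  \<open>\<pi> = 1\<close>) and break the doubling of \<open>z\<close>. The upper bound on
  \<open>j\<close> is claimed only once a 1 was chosen: for an all-zero prefix it would say that
  \<open>j\<close> is not too large, which is still unknown. There the stored count \<open>c\<close>
  is exact instead.\<close>

definition search_inv :: "nat \<Rightarrow> nat \<Rightarrow> nat \<Rightarrow> nat \<Rightarrow> nat \<Rightarrow> nat \<Rightarrow> nat \<Rightarrow> nat \<Rightarrow> nat \<Rightarrow> bool" where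
  "search_inv X n j l p F E z c \<longleftrightarrow>
     p < 2 ^ l \<and> F = X ^ n - block_poly X n (word p) l \<and> E = weighted_poly X n (word p) l \<and>
     prenecklace (word p) l \<and> (\<exists>\<pi>. min_period (word p) l \<pi> \<and> z = 2 ^ (l + 1 - \<pi>)) \<and>
     card (gt_necklaces n l (word p)) < j \<and>
     (p = 0 \<longrightarrow> c = card (gt_necklaces n l (word p))) \<and>
     (p \<noteq> 0 \<longrightarrow> j \<le> card (ge_necklaces n l (word p)))"

lemma search_invI:
  assumes "p < 2 ^ l" "F = X ^ n - block_poly X n (word p) l" "E = weighted_poly X n (word p) l"
    "prenecklace (word p) l" "min_period (word p) l \<pi>" "z = 2 ^ (l + 1 - \<pi>)"
    "card (gt_necklaces n l (word p)) < j"
    "p = 0 \<Longrightarrow> c = card (gt_necklaces n l (word p))"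
    "p \<noteq> 0 \<Longrightarrow> j \<le> card (ge_necklaces n l (word p))"
  shows "search_inv X n j l p F E z c"
  unfolding search_inv_def using assms by blast

lemma search_invD:
  assumes "search_inv X n j l p F E z c"
  shows "F = X ^ n - block_poly X n (word p) l" "E = weighted_poly X n (word p) l"
    "p = 0 \<Longrightarrow> c = card (gt_necklaces n l (word p))"
    "p \<noteq> 0 \<Longrightarrow> j \<le> card (ge_necklaces n l (word p))"
  using assms unfolding search_inv_def by blast+

definition forced :: "nat \<Rightarrow> nat \<Rightarrow> bool" where
  "forced p z \<longleftrightarrow> (2 * p) div z mod 2 = 1"

lemma search_inv_0: "1 \<le> j \<Longrightarrow> search_inv X n j 0 0 (X ^ n) 0 1 0"
  by (rule search_invI[where \<pi> = 1])
    (simp_all add: block_poly_def weighted_poly_def zeros_def prenecklace_def min_period_def gt_necklaces_0 neq0_conv[symmetric] del: neq0_conv)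

text \<open>Doubling \<open>p\<close> compensates for the extra 1 in the exponent of
  \<open>z\<close>, so the division extracts the bit one minimal period before the new one.\<close>

lemma forced_iff:
  assumes p: "p < 2 ^ l" and mp: "min_period (word p) l \<pi>" and z: "z = 2 ^ (l + 1 - \<pi>)"
  shows "forced p z \<longleftrightarrow> 0 < l \<and> word p (l - \<pi>)"
proof (cases "l = 0")
  case True
  then show ?thesis using p by (simp add: forced_def)
next
  case False
  then have "\<pi> \<le> l" using mp by (simp add: min_period_def)
  then have "z = 2 * 2 ^ (l - \<pi>)" unfolding z by (simp add: Suc_diff_le)
  then have "(2 * p) div z = p div 2 ^ (l - \<pi>)" by simp
  then show ?thesis using False by (simp add: forced_def word_def odd_iff_mod_2_eq_one)
qed

lemma prenecklace_upd: "prenecklace w l \<Longrightarrow> prenecklace (w(l := b)) l"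
  unfolding prenecklace_def
proof (intro allI impI)
  fix i s
  assume pre: "\<forall>i<l. \<forall>s. \<not> w i \<and> 0 < s \<and> s \<le> i \<and> (\<forall>u<i - s. w (s + u) = w u) \<longrightarrow> \<not> w (i - s)"
    and i: "i < l"
    and s: "\<not> (w(l := b)) i \<and> 0 < s \<and> s \<le> i \<and> (\<forall>u<i - s. (w(l := b)) (s + u) = (w(l := b)) u)"
  have "w (s + u) = w u" if "u < i - s" for u
  proof -
    have "(w(l := b)) (s + u) = (w(l := b)) u" using s that by blast
    then show ?thesis using that i by (simp split: if_splits)
  qed
  then have "\<not> w (i - s)" using pre[rule_format, of i s] i s by simp
  moreover have "i - s \<noteq> l" using i by linarith
  ultimately show "\<not> (w(l := b)) (i - s)" by simp
qed

lemma min_period_upd: "min_period w l p \<Longrightarrow> min_period (w(l := b)) l p"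
  unfolding min_period_def
proof (elim conjE, intro conjI allI impI)
  fix u assume "\<forall>u. u + p < l \<longrightarrow> w (u + p) = w u" "u + p < l"
  then show "(w(l := b)) (u + p) = (w(l := b)) u" by simp
next
  fix s assume "\<forall>s. 0 < s \<and> s < p \<longrightarrow> (\<exists>u. u + s < l \<and> w (u + s) \<noteq> w u)" "0 < s \<and> s < p"
  then obtain u where "u + s < l" "w (u + s) \<noteq> w u" by blast
  then show "\<exists>u. u + s < l \<and> (w(l := b)) (u + s) \<noteq> (w(l := b)) u" by (intro exI[of _ u]) simp
qed

lemma doubled_power: "min_period w l \<pi> \<Longrightarrow> (2 :: nat) ^ (l + 1 - \<pi>) * 2 = 2 ^ (Suc l + 1 - \<pi>)"
proof -
  assume "min_period w l \<pi>"
  then have "Suc l + 1 - \<pi> = Suc (l + 1 - \<pi>)" unfolding min_period_def by linarith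
  then show ?thesis by (simp only: power_Suc mult.commute)
qed

text \<open>\<open>c'\<close> is arbitrary because a forced bit needs an earlier 1, and the stored
  count matters only for all-zero prefixes.\<close>

lemma search_inv_forced:
  assumes inv: "search_inv X n j l p F E z c" and l: "l < n" and f: "forced p z"
  shows "search_inv X n j (Suc l) (p + 2 ^ l) F E (z * 2) c'"
proof -
  let ?w = "word p" and ?v = "(word p)(l := True)"
  have p: "p < 2 ^ l" and pre: "prenecklace ?w l" and c: "card (gt_necklaces n l ?w) < j"
    using inv unfolding search_inv_def by blast+
  obtain \<pi> where mp: "min_period ?w l \<pi>" and z: "z = 2 ^ (l + 1 - \<pi>)"
    using inv unfolding search_inv_def by blast+
  have f': "0 < l" "?w (l - \<pi>)" using f forced_iff[OF p mp z] by auto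
  have wl: "\<not> ?w l" using word_ge[OF p, of l] by simp
  have "p \<noteq> 0" using f'(2) unfolding word_def by (cases "p = 0") auto
  then have ge: "j \<le> card (ge_necklaces n l ?w)" using inv by (simp add: search_inv_def)
  have "\<pi> \<noteq> 0" using mp by (simp add: min_period_def)
  then have mp': "min_period ?v (Suc l) \<pi>"
    using mp f' by (intro min_period_Suc_same) (auto simp: min_period_upd)
  have pre': "prenecklace ?v (Suc l)"
    using pre by (intro prenecklace_Suc_True) (auto simp: prenecklace_upd)
  have ge': "j \<le> card (ge_necklaces n (Suc l) ?v)"
    using ge forced_bit[OF f'(1) l mp f'(2) wl] by (simp add: ge_necklaces_Suc_True[of ?w, OF wl])
  show ?thesis
  proof (rule search_invI[where \<pi> = \<pi>])
    show "z * 2 = 2 ^ (Suc l + 1 - \<pi>)" unfolding z by (rule doubled_power[OF mp])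
    show "card (gt_necklaces n (Suc l) (word (p + 2 ^ l))) < j"
      unfolding word_add[OF p] gt_necklaces_Suc_True by (rule c)
    show "prenecklace (word (p + 2 ^ l)) (Suc l)" "min_period (word (p + 2 ^ l)) (Suc l) \<pi>"
      "j \<le> card (ge_necklaces n (Suc l) (word (p + 2 ^ l)))"
      unfolding word_add[OF p] by (fact pre' mp' ge')+
    show "F = X ^ n - block_poly X n (word (p + 2 ^ l)) (Suc l)"
      "E = weighted_poly X n (word (p + 2 ^ l)) (Suc l)"
      unfolding word_add[OF p] poly_Suc_True by (fact search_invD(1,2)[OF inv])+
  qed (use p in simp_all)
qed

lemma search_inv_zero:
  assumes inv: "search_inv X n j l p F E z c" and l: "l < n" and f: "\<not> forced p z"
    and c: "c' = card (gt_necklaces n (Suc l) (word p))" "c' < j"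
  shows "search_inv X n j (Suc l) p (F - X ^ (n - 1 - l)) (E + (l + 1) * X ^ (n - 1 - l)) (z * 2) c'"
proof -
  let ?w = "word p"
  have p: "p < 2 ^ l" and pre: "prenecklace ?w l"
    using inv unfolding search_inv_def by blast+
  obtain \<pi> where mp: "min_period ?w l \<pi>" and z: "z = 2 ^ (l + 1 - \<pi>)"
    using inv unfolding search_inv_def by blast+
  have f': "l = 0 \<or> \<not> ?w (l - \<pi>)" using f forced_iff[OF p mp z] by auto
  have wl: "\<not> ?w l" using word_ge[OF p, of l] by simp
  show ?thesis
  proof (rule search_invI[where \<pi> = \<pi>])
    show "p < 2 ^ Suc l" using p by simp
    show "z * 2 = 2 ^ (Suc l + 1 - \<pi>)" unfolding z by (rule doubled_power[OF mp])
    show "min_period ?w (Suc l) \<pi>" using mp f' wl by (intro min_period_Suc_same) auto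
    show "prenecklace ?w (Suc l)" by (rule prenecklace_Suc_False[OF pre mp f'])
    show "p \<noteq> 0 \<Longrightarrow> j \<le> card (ge_necklaces n (Suc l) ?w)"
      using search_invD(4)[OF inv] unfolding necklaces_Suc_False[of ?w, OF wl] .
    show "F - X ^ (n - 1 - l) = X ^ n - block_poly X n ?w (Suc l)"
      unfolding search_invD(1)[OF inv] block_poly_Suc_False[of ?w, OF wl] by simp
    show "E + (l + 1) * X ^ (n - 1 - l) = weighted_poly X n ?w (Suc l)"
      unfolding search_invD(2)[OF inv] weighted_poly_Suc_False[of ?w, OF wl] ..
    show "card (gt_necklaces n (Suc l) ?w) < j" using c by simp
    show "c' = card (gt_necklaces n (Suc l) ?w)" by (rule c(1))
  qed
qed

text \<open>The new minimal period is the full length \<open>Suc l\<close>, so the exponent of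
  \<open>z\<close> restarts at 1. The count that rejected the 0 is the weak count for the prefix
  ending in 1, which yields the upper bound on \<open>j\<close>.\<close>

lemma search_inv_one:
  assumes inv: "search_inv X n j l p F E z c" and l: "l < n" and f: "\<not> forced p z"
    and c: "c' = card (gt_necklaces n (Suc l) (word p))" "\<not> c' < j"
  shows "search_inv X n j (Suc l) (p + 2 ^ l) F E 2 c'"
proof -
  let ?w = "word p" and ?v = "(word p)(l := True)"
  have p: "p < 2 ^ l" and pre: "prenecklace ?w l" and cj: "card (gt_necklaces n l ?w) < j"
    using inv unfolding search_inv_def by blast+
  obtain \<pi> where mp: "min_period ?w l \<pi>" and z: "z = 2 ^ (l + 1 - \<pi>)"
    using inv unfolding search_inv_def by blast+
  have f': "l = 0 \<or> \<not> ?w (l - \<pi>)" using f forced_iff[OF p mp z] by auto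
  have wl: "\<not> ?w l" using word_ge[OF p, of l] by simp
  have pi0: "\<pi> \<noteq> 0" using mp by (simp add: min_period_def)
  have mp': "min_period ?v (Suc l) (Suc l)"
    by (rule min_period_Suc_new[of ?v l \<pi>]) (use pre mp f' pi0 in \<open>auto simp: prenecklace_upd min_period_upd\<close>)
  have pre': "prenecklace ?v (Suc l)"
    using pre by (intro prenecklace_Suc_True) (auto simp: prenecklace_upd)
  have ge': "j \<le> card (ge_necklaces n (Suc l) ?v)"
    using c by (simp add: ge_necklaces_Suc_True[of ?w, OF wl])
  show ?thesis
  proof (rule search_invI[where \<pi> = "Suc l"])
    show "(2 :: nat) = 2 ^ (Suc l + 1 - Suc l)" by simp
    show "card (gt_necklaces n (Suc l) (word (p + 2 ^ l))) < j"
      unfolding word_add[OF p] gt_necklaces_Suc_True by (rule cj)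
    show "prenecklace (word (p + 2 ^ l)) (Suc l)" "min_period (word (p + 2 ^ l)) (Suc l) (Suc l)"
      "j \<le> card (ge_necklaces n (Suc l) (word (p + 2 ^ l)))"
      unfolding word_add[OF p] by (fact pre' mp' ge')+
    show "F = X ^ n - block_poly X n (word (p + 2 ^ l)) (Suc l)"
      "E = weighted_poly X n (word (p + 2 ^ l)) (Suc l)"
      unfolding word_add[OF p] poly_Suc_True by (fact search_invD(1,2)[OF inv])+
  qed (use p in simp_all)
qed

lemma search_inv_count:
  assumes inv: "search_inv X n j l p F E z c" and l: "l < n" and X: "X = 64 ^ n" and f: "\<not> forced p z"
  shows "((X ^ n * X ^ n div (F - X ^ (n - 1 - l))) * ((E + (l + 1) * X ^ (n - 1 - l)) * (\<Sum>q=1..n. X ^ gcd n q)))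
      div (X ^ n * X ^ n) mod X div n = card (gt_necklaces n (Suc l) (word p))"
proof -
  let ?w = "word p"
  have p: "p < 2 ^ l" and pre: "prenecklace ?w l"
    using inv unfolding search_inv_def by blast+
  obtain \<pi> where mp: "min_period ?w l \<pi>" and z: "z = 2 ^ (l + 1 - \<pi>)"
    using inv unfolding search_inv_def by blast+
  have f': "l = 0 \<or> \<not> ?w (l - \<pi>)" using f forced_iff[OF p mp z] by auto
  have wl: "\<not> ?w l" using word_ge[OF p, of l] by simp
  have pre': "prenecklace ?w (Suc l)" by (rule prenecklace_Suc_False[OF pre mp f'])
  have n: "0 < n" "Suc l \<le> n" using l by auto
  have F: "F - X ^ (n - 1 - l) = X ^ n - block_poly X n ?w (Suc l)"
    using inv unfolding search_inv_def block_poly_Suc_False[of ?w, OF wl] by simp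
  have E: "E + (l + 1) * X ^ (n - 1 - l) = weighted_poly X n ?w (Suc l)"
    using inv unfolding search_inv_def weighted_poly_Suc_False[of ?w, OF wl] by simp
  show ?thesis unfolding F E by (rule necklace_count_formula[OF n pre' X])
qed

text \<open>If all bits are 0, exactly one necklace, that of the zero string, is not strictly above
  the word. Hence \<open>c + 1\<close> is the number of necklaces, and comparing it with
  \<open>j\<close> decides "too large".\<close>

lemma search_inv_selects:
  assumes inv: "search_inv X n j n p F E z c"
  shows "if p = 0 \<and> c + 1 < j then card (necklaces n) < j
    else selects n j (word p) \<and> j \<le> card (necklaces n)"
proof (cases "p = 0")
  case False
  then have s: "selects n j (word p)" using inv by (simp add: search_inv_def selects_def)
  have "card (ge_necklaces n n (word p)) \<le> card (necklaces n)"
    by (rule card_mono) (auto simp: ge_necklaces_def)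
  then show ?thesis using s False by (simp add: selects_def)
next
  case True
  let ?w = "word p"
  have w: "\<not> ?w i" for i using True by (simp add: word_def)
  have "lge n x ?w" for x using lgt_total[of n x ?w] w by (auto simp: lge_def lgt_def)
  then have ge: "ge_necklaces n n ?w = necklaces n" by (auto simp: ge_necklaces_def)
  let ?c = "necklace_rel n `` {replicate n False}"
  have mem: "replicate n False \<in> ?c" by (subst necklace_class) (auto intro!: exI[of _ 0])
  have "?c \<in> necklaces n" unfolding necklaces_def by (rule quotientI) (simp add: bin_strings_def)
  moreover have "?c \<notin> gt_necklaces n n ?w"
  proof
    assume "?c \<in> gt_necklaces n n ?w"
    then have "lgt n ((!) (replicate n False)) ?w" using mem by (simp only: gt_necklaces_def mem_Collect_eq)
    then show False using w by (auto simp: lgt_def)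
  qed
  ultimately have "gt_necklaces n n ?w \<subset> necklaces n" by (auto simp: gt_necklaces_def)
  then have "card (gt_necklaces n n ?w) < card (necklaces n)" by (intro psubset_card_mono) auto
  then have "selects n (card (gt_necklaces n n ?w) + 1) ?w" by (simp add: selects_def ge)
  then have "card (gt_necklaces n n ?w) + 1 = card (necklaces n)" using selects_class(2) ge by metis
  then show ?thesis using inv True ge by (auto simp: search_inv_def selects_def)
qed

section \<open>The program\<close>

text \<open>
  Registers: 4 holds \<open>X = 64\<^sup>n\<close>, 5 holds \<open>X\<^sup>n\<close>, 6 the loop counter \<open>l\<close>, 7 the sum of the \<open>X\<close>-powers with
  exponents \<open>gcd n q\<close>. Euclid's algorithm by subtraction runs on the exponents of the powers of \<open>X\<close> in 9 and 10,
  so that subtraction becomes division; 8 holds the current power. In the search, 11 and 12 hold the polynomials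
  of the tiles at \<open>X\<close>, 13 is \<open>X\<^bsup>n-1-l\<^esup>\<close>, 14 is \<open>2\<^bsup>l+1-\<pi>\<^esup>\<close> for the minimal period \<open>\<pi>\<close>, 15 is \<open>2\<^sup>l\<close>, 16 the last count, and
  17 and 18 the candidates for 11 and 12.
\<close>

definition gcd_step :: com where
  "gcd_step = If (Less (Var 9) (Var 10)) (Assign 10 (Div (Var 10) (Var 9))) (Assign 9 (Div (Var 9) (Var 10)))"

definition gcd_loop :: com where
  "gcd_loop = While (Not (Eq (Var 9) (Var 10))) gcd_step"

definition gcd_load :: com where
  "gcd_load = Seq (Assign 9 (Var 5)) (Assign 10 (Var 8))"

definition gcd_store :: com where
  "gcd_store = Seq (Assign 7 (Plus (Var 7) (Var 9))) (Assign 8 (Mult (Var 8) (Var 4)))"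

definition power_pass :: com where
  "power_pass = Seq (Assign 4 (Num 1)) (for_n (Assign 4 (Mult (Var 4) (Num 64))))"

definition power_pass2 :: com where
  "power_pass2 = Seq (Assign 5 (Num 1)) (for_n (Assign 5 (Mult (Var 5) (Var 4))))"

definition gcd_pass :: com where
  "gcd_pass = Seq (Seq (Assign 8 (Var 4)) (Assign 7 (Num 0)))
    (for_n (Seq gcd_load (Seq gcd_loop gcd_store)))"

definition search_init :: com where
  "search_init = Seq (Assign 11 (Var 5)) (Seq (Assign 12 (Num 0)) (Seq (Assign 13 (Div (Var 5) (Var 4)))
    (Seq (Assign 14 (Num 1)) (Assign 15 (Num 1)))))"

definition count_candidate :: com where
  "count_candidate =
    Seq (Assign 17 (Minus (Var 11) (Var 13)))
    (Seq (Assign 18 (Plus (Var 12) (Mult (Plus (Var 6) (Num 1)) (Var 13))))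
    (Assign 16 (Div (Mod (Div
      (Mult (Div (Mult (Var 5) (Var 5)) (Var 17)) (Mult (Var 18) (Var 7)))
      (Mult (Var 5) (Var 5))) (Var 4)) (Var 0))))"

definition choose_bit :: com where
  "choose_bit =
    If (Eq (Mod (Div (Mult (Num 2) (Var 3)) (Var 14)) (Num 2)) (Num 1))
      (Seq (Assign 3 (Plus (Var 3) (Var 15))) (Assign 14 (Mult (Var 14) (Num 2))))
      (If (Less (Var 16) (Var 1))
        (Seq (Assign 11 (Var 17)) (Seq (Assign 12 (Var 18)) (Assign 14 (Mult (Var 14) (Num 2)))))
        (Seq (Assign 3 (Plus (Var 3) (Var 15))) (Assign 14 (Num 2))))"

definition advance :: com where
  "advance = Seq (Assign 13 (Div (Var 13) (Var 4))) (Assign 15 (Mult (Var 15) (Num 2)))"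

definition search_body :: com where
  "search_body = Seq count_candidate (Seq choose_bit advance)"

definition check_index :: com where
  "check_index = If (And (Eq (Var 3) (Num 0)) (Less (Plus (Var 16) (Num 1)) (Var 1))) (Assign 2 (Num 1)) SKIP"

definition unrank :: com where
  "unrank = Seq power_pass (Seq power_pass2 (Seq gcd_pass (Seq search_init (Seq (for_n search_body) check_index))))"

section \<open>Correctness and cost of the passes\<close>

definition gcd_unit :: nat where
  "gcd_unit = csz gcd_step + bsz (Not (Eq (Var 9) (Var 10))) + 1"

text \<open>The sum of the two exponents is the variant. \<open>1 < X\<close> ensures that comparing
  the powers compares the exponents.\<close>

lemma runs_gcd_loop:
  assumes X: "1 < X" and s: "bounded V s" "s 9 = X ^ x" "s 10 = X ^ y" "0 < x" "0 < y"
  shows "runs V gcd_loop s ((x + y) * gcd_unit + gcd_unit)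
    (\<lambda>s'. s' 9 = X ^ gcd x y \<and> (\<forall>r. r \<noteq> 9 \<and> r \<noteq> 10 \<longrightarrow> s' r = s r))"
proof -
  let ?b = "Not (Eq (Var 9) (Var 10))"
  define Inv where "Inv = (\<lambda>k s'. \<exists>u v. 0 < u \<and> 0 < v \<and> u + v = k \<and> gcd u v = gcd x y \<and>
    s' 9 = X ^ u \<and> s' 10 = X ^ v \<and> (\<forall>r. r \<noteq> 9 \<and> r \<noteq> 10 \<longrightarrow> s' r = s r))"
  have "runs V gcd_loop s ((x + y) * (csz gcd_step + bsz ?b + 1) + (bsz ?b + 1))
      (\<lambda>s'. (\<exists>k. Inv k s') \<and> \<not> bval ?b s')"
    unfolding gcd_loop_def
  proof (rule runs_While[where Inv = Inv])
    show "bounded V s" "Inv (x + y) s" using s by (auto simp: Inv_def)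
    fix k s' assume bs: "bounded V s'" and inv: "Inv k s'" and ne: "bval ?b s'"
    obtain u v where uv: "0 < u" "0 < v" "u + v = k" "gcd u v = gcd x y" "s' 9 = X ^ u" "s' 10 = X ^ v"
      and fr: "\<forall>r. r \<noteq> 9 \<and> r \<noteq> 10 \<longrightarrow> s' r = s r" using inv unfolding Inv_def by blast
    have "u \<noteq> v" using ne uv by auto
    have lt: "s' 9 < s' 10 \<longleftrightarrow> u < v" using X uv by simp
    have b: "s' 9 < 2 ^ V" "s' 10 < 2 ^ V" using bs by (auto simp: bounded_def)
    show "runs V gcd_step s' (csz gcd_step) (\<lambda>s'. \<exists>k'<k. Inv k' s')"
    proof (rule wp_runs[OF bs], cases "u < v")
      case True
      have d: "s' 10 div s' 9 = X ^ (v - u)" using True X uv by (simp add: power_diff)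
      have g: "gcd u (v - u) = gcd x y" using True uv(4) by (metis gcd.commute gcd_diff1_nat less_imp_le)
      have "Inv v (s'(10 := X ^ (v - u)))"
        unfolding Inv_def using True uv fr g by (intro exI[of _ u] exI[of _ "v - u"]) simp
      then have "\<exists>k'<k. Inv k' (s'(10 := X ^ (v - u)))" using uv(1,3) by (intro exI[of _ v]) simp
      moreover have "X ^ (v - u) < 2 ^ V" unfolding d[symmetric]
        by (rule order.strict_trans1[OF div_le_dividend b(2)])
      ultimately show "wp V gcd_step (\<lambda>s'. \<exists>k'<k. Inv k' s') s'"
        using True lt d unfolding gcd_step_def by simp
    next
      case False
      then have vu: "v < u" using \<open>u \<noteq> v\<close> by simp
      have d: "s' 9 div s' 10 = X ^ (u - v)" using vu X uv by (simp add: power_diff)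
      have g: "gcd (u - v) v = gcd x y" using vu uv(4) by (metis gcd_diff1_nat less_imp_le)
      have "Inv u (s'(9 := X ^ (u - v)))"
        unfolding Inv_def using vu uv fr g by (intro exI[of _ "u - v"] exI[of _ v]) simp
      then have "\<exists>k'<k. Inv k' (s'(9 := X ^ (u - v)))" using uv(2,3) by (intro exI[of _ u]) simp
      moreover have "X ^ (u - v) < 2 ^ V" unfolding d[symmetric]
        by (rule order.strict_trans1[OF div_le_dividend b(1)])
      ultimately show "wp V gcd_step (\<lambda>s'. \<exists>k'<k. Inv k' s') s'"
        using False lt d unfolding gcd_step_def by simp
    qed
  qed
  then have "runs V gcd_loop s ((x + y) * (csz gcd_step + bsz ?b + 1) + (bsz ?b + 1))
      (\<lambda>s'. s' 9 = X ^ gcd x y \<and> (\<forall>r. r \<noteq> 9 \<and> r \<noteq> 10 \<longrightarrow> s' r = s r))"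
  proof (rule runs_post)
    fix s' assume q: "(\<exists>k. Inv k s') \<and> \<not> bval ?b s'"
    then obtain u v where uv: "gcd u v = gcd x y" "s' 9 = X ^ u" "s' 10 = X ^ v"
      "\<forall>r. r \<noteq> 9 \<and> r \<noteq> 10 \<longrightarrow> s' r = s r" unfolding Inv_def by blast
    have "X ^ u = X ^ v" using q uv by simp
    then have "u = v" using X by simp
    then show "s' 9 = X ^ gcd x y \<and> (\<forall>r. r \<noteq> 9 \<and> r \<noteq> 10 \<longrightarrow> s' r = s r)" using uv by simp
  qed
  then show ?thesis by (rule runs_mono) (simp add: gcd_unit_def)
qed

lemma bounded_le: "bounded V s \<Longrightarrow> s r < 2 ^ V"
  by (simp add: bounded_def)

definition gcd_cost :: "nat \<Rightarrow> nat" where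
  "gcd_cost m = csz gcd_load + ((2 * m + 1) * gcd_unit + csz gcd_store + 1) + 1"

definition gcd_sum :: "nat \<Rightarrow> nat \<Rightarrow> nat" where
  "gcd_sum n X = (\<Sum>q=1..n. X ^ gcd n q)"

text \<open>Register 13 is specified only for \<open>l < n\<close>: after the last round it has been
  divided once too often and is no longer the required power.\<close>

definition search_state :: "nat \<Rightarrow> nat \<Rightarrow> nat \<Rightarrow> nat \<Rightarrow> state \<Rightarrow> bool" where
  "search_state n j X l s \<longleftrightarrow> s 0 = n \<and> s 1 = j \<and> s 2 = 0 \<and> s 4 = X \<and> s 5 = X ^ n \<and> s 6 = l \<and> s 7 = gcd_sum n X \<and>
    s 15 = 2 ^ l \<and> (l < n \<longrightarrow> s 13 = X ^ (n - 1 - l)) \<and> search_inv X n j l (s 3) (s 11) (s 12) (s 14) (s 16)"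

definition unrank_cost :: "nat \<Rightarrow> nat" where
  "unrank_cost n =
    (csz (Assign 4 (Num 1)) + (n * (csz (Assign 4 (Mult (Var 4) (Num 64))) + for_n_overhead) + for_n_overhead) + 1) +
    ((csz (Assign 5 (Num 1)) + (n * (csz (Assign 5 (Mult (Var 5) (Var 4))) + for_n_overhead) + for_n_overhead) + 1) +
    ((csz (Seq (Assign 8 (Var 4)) (Assign 7 (Num 0))) + (n * (gcd_cost n + for_n_overhead) + for_n_overhead) + 1) +
    (csz search_init + ((n * (csz search_body + for_n_overhead) + for_n_overhead) + csz check_index + 1) + 1) + 1) + 1) + 1"

text \<open>\<open>V\<close> is chosen so that \<open>2 ^ V\<close> exceeds
  \<open>X ^ (n + 1) = 2 ^ (6 * n * (n + 1))\<close>, the value of register 8 after the last gcd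
  round and a bound for the sum in register 7. The linear slack and \<open>bitlen j\<close> take
  care of the small registers and of \<open>j\<close>.\<close>

context
  fixes n j X V :: nat
  assumes X: "X = 64 ^ n" and V: "V = 6 * n * n + 7 * n + 8 + bitlen j"
begin

lemma power_bound: "i \<le> n + 1 \<Longrightarrow> X ^ i < 2 ^ V"
proof -
  assume i: "i \<le> n + 1"
  have "6 * (n * i) \<le> 6 * (n * (n + 1))" by (intro mult_le_mono2 i)
  also have "\<dots> < V" by (simp add: V algebra_simps)
  finally have "(2 :: nat) ^ (6 * (n * i)) < 2 ^ V" by simp
  moreover have "X ^ i = 2 ^ (6 * (n * i))" unfolding X by (simp add: power_mult)
  ultimately show ?thesis by simp
qed

lemma small_bound: "i \<le> n + 7 \<Longrightarrow> (2 :: nat) ^ i < 2 ^ V"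
  by (simp add: V)

lemma index_bound: "i \<le> n \<Longrightarrow> i < 2 ^ V"
  using order.strict_trans[OF less_exp[of i] small_bound[of i]] by simp

lemma j_bound: "j < 2 ^ V"
proof -
  have "(2 :: nat) ^ bitlen j \<le> 2 ^ V" by (rule power_increasing) (simp_all add: V)
  then show ?thesis by (rule order.strict_trans2[OF less_2_bitlen])
qed

lemma runs_power_pass:
  assumes s: "bounded V s" "s 0 = n" "s 1 = j" "s 2 = 0" "s 3 = 0" "s 16 = 0"
  shows "runs V power_pass s
    (csz (Assign 4 (Num 1)) + (n * (csz (Assign 4 (Mult (Var 4) (Num 64))) + for_n_overhead) + for_n_overhead) + 1)
    (\<lambda>s. s 0 = n \<and> s 1 = j \<and> s 2 = 0 \<and> s 3 = 0 \<and> s 16 = 0 \<and> s 4 = X)"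
  unfolding power_pass_def
proof (rule runs_Seq)
  let ?base = "\<lambda>s. s 0 = n \<and> s 1 = j \<and> s 2 = (0 :: nat) \<and> s 3 = (0 :: nat) \<and> s 16 = (0 :: nat)"
  let ?I = "\<lambda>l s. ?base s \<and> s 6 = l \<and> s 4 = 64 ^ l"
  have one: "1 < (2 :: nat) ^ V" using small_bound[of 0] by simp
  show "runs V (Assign 4 (Num 1)) s (csz (Assign 4 (Num 1))) (\<lambda>s. ?base s \<and> s 4 = 1)"
    by (rule wp_runs[OF s(1)]) (use s one in simp)
  fix s1 assume s1: "bounded V s1" "?base s1 \<and> s1 4 = 1"
  have "runs V (for_n (Assign 4 (Mult (Var 4) (Num 64)))) s1
      (n * (csz (Assign 4 (Mult (Var 4) (Num 64))) + for_n_overhead) + for_n_overhead) (?I n)"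
  proof (rule runs_for_n[where I = ?I, OF index_bound[OF order.refl] s1(1)])
    show "s1 0 = n" "?I 0 (s1(6 := 0))" using s1 by auto
    show "s 0 = n \<and> s 6 = l" if "?I l s" for l s using that by blast
    fix l s assume bs: "bounded V s" and l: "l < n" and I: "?I l s"
    have "(64 :: nat) ^ Suc l \<le> 64 ^ n" using l by (intro power_increasing) auto
    also have "\<dots> < 2 ^ V" using power_bound[of 1] by (simp add: X)
    finally show "runs V (Assign 4 (Mult (Var 4) (Num 64))) s (csz (Assign 4 (Mult (Var 4) (Num 64))))
        (\<lambda>s'. s' 6 = l \<and> ?I (Suc l) (s'(6 := Suc l)))"
      by (intro wp_runs[OF bs]) (use I in \<open>simp add: mult.commute\<close>)
  qed
  then show "runs V (for_n (Assign 4 (Mult (Var 4) (Num 64)))) s1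
      (n * (csz (Assign 4 (Mult (Var 4) (Num 64))) + for_n_overhead) + for_n_overhead) (\<lambda>s. s 0 = n \<and> s 1 = j \<and> s 2 = 0 \<and> s 3 = 0 \<and> s 16 = 0 \<and> s 4 = X)"
    by (rule runs_post) (simp add: X)
qed

lemma runs_power_pass2:
  assumes s: "bounded V s" "s 0 = n" "s 1 = j" "s 2 = 0" "s 3 = 0" "s 16 = 0" "s 4 = X"
  shows "runs V power_pass2 s
    (csz (Assign 5 (Num 1)) + (n * (csz (Assign 5 (Mult (Var 5) (Var 4))) + for_n_overhead) + for_n_overhead) + 1)
    (\<lambda>s. s 0 = n \<and> s 1 = j \<and> s 2 = 0 \<and> s 3 = 0 \<and> s 16 = 0 \<and> s 4 = X \<and> s 5 = X ^ n)"
  unfolding power_pass2_def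
proof (rule runs_Seq)
  let ?base = "\<lambda>s. s 0 = n \<and> s 1 = j \<and> s 2 = (0 :: nat) \<and> s 3 = (0 :: nat) \<and> s 16 = (0 :: nat) \<and> s 4 = X"
  let ?I = "\<lambda>l s. ?base s \<and> s 6 = l \<and> s 5 = X ^ l"
  have one: "1 < (2 :: nat) ^ V" using small_bound[of 0] by simp
  show "runs V (Assign 5 (Num 1)) s (csz (Assign 5 (Num 1))) (\<lambda>s. ?base s \<and> s 5 = 1)"
    by (rule wp_runs[OF s(1)]) (use s one in simp)
  fix s1 assume s1: "bounded V s1" "?base s1 \<and> s1 5 = 1"
  have "runs V (for_n (Assign 5 (Mult (Var 5) (Var 4)))) s1
      (n * (csz (Assign 5 (Mult (Var 5) (Var 4))) + for_n_overhead) + for_n_overhead) (?I n)"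
  proof (rule runs_for_n[where I = ?I, OF index_bound[OF order.refl] s1(1)])
    show "s1 0 = n" "?I 0 (s1(6 := 0))" using s1 by auto
    show "s 0 = n \<and> s 6 = l" if "?I l s" for l s using that by blast
    fix l s assume bs: "bounded V s" and l: "l < n" and I: "?I l s"
    have "X ^ Suc l < 2 ^ V" using l by (intro power_bound) auto
    then show "runs V (Assign 5 (Mult (Var 5) (Var 4))) s (csz (Assign 5 (Mult (Var 5) (Var 4))))
        (\<lambda>s'. s' 6 = l \<and> ?I (Suc l) (s'(6 := Suc l)))"
      by (intro wp_runs[OF bs]) (use I in \<open>simp add: mult.commute\<close>)
  qed
  then show "runs V (for_n (Assign 5 (Mult (Var 5) (Var 4)))) s1
      (n * (csz (Assign 5 (Mult (Var 5) (Var 4))) + for_n_overhead) + for_n_overhead)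
      (\<lambda>s. s 0 = n \<and> s 1 = j \<and> s 2 = 0 \<and> s 3 = 0 \<and> s 16 = 0 \<and> s 4 = X \<and> s 5 = X ^ n)"
    by (rule runs_post) simp
qed

lemma runs_gcd_pass:
  assumes s: "bounded V s" "s 0 = n" "s 1 = j" "s 2 = 0" "s 3 = 0" "s 16 = 0" "s 4 = X" "s 5 = X ^ n"
  shows "runs V gcd_pass s
    (csz (Seq (Assign 8 (Var 4)) (Assign 7 (Num 0))) + (n * (gcd_cost n + for_n_overhead) + for_n_overhead) + 1)
    (\<lambda>s. s 0 = n \<and> s 1 = j \<and> s 2 = 0 \<and> s 3 = 0 \<and> s 16 = 0 \<and> s 4 = X \<and> s 5 = X ^ n \<and> s 7 = gcd_sum n X)"
  unfolding gcd_pass_def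
proof (rule runs_Seq)
  let ?base = "\<lambda>s. s 0 = n \<and> s 1 = j \<and> s 2 = (0 :: nat) \<and> s 3 = (0 :: nat) \<and> s 16 = (0 :: nat) \<and> s 4 = X \<and> s 5 = X ^ n"
  let ?I = "\<lambda>l s. ?base s \<and> s 6 = l \<and> s 7 = (\<Sum>q=1..l. X ^ gcd n q) \<and> s 8 = X ^ Suc l"
  have one: "0 < (2 :: nat) ^ V" by simp
  show "runs V (Seq (Assign 8 (Var 4)) (Assign 7 (Num 0))) s (csz (Seq (Assign 8 (Var 4)) (Assign 7 (Num 0))))
      (\<lambda>s. ?base s \<and> s 7 = 0 \<and> s 8 = X)"
    by (rule wp_runs[OF s(1)]) (use s one bounded_le[OF s(1), of 4] in simp)
  fix s1 assume s1: "bounded V s1" "?base s1 \<and> s1 7 = 0 \<and> s1 8 = X"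
  let ?c = "Seq gcd_load (Seq gcd_loop gcd_store)"
  have "runs V (for_n ?c) s1 (n * (gcd_cost n + for_n_overhead) + for_n_overhead) (?I n)"
  proof (rule runs_for_n[where I = ?I, OF index_bound[OF order.refl] s1(1)])
    show "s1 0 = n" "?I 0 (s1(6 := 0))" using s1 by auto
    show "s 0 = n \<and> s 6 = l" if "?I l s" for l s using that by blast
    fix l s assume bs: "bounded V s" and l: "l < n" and I: "?I l s"
    have X1: "1 < X" using l unfolding X by (intro one_less_power) auto
    have "runs V ?c s (csz gcd_load + (((n + Suc l) * gcd_unit + gcd_unit) + csz gcd_store + 1) + 1)
        (\<lambda>s'. s' 6 = l \<and> ?I (Suc l) (s'(6 := Suc l)))"
    proof (rule runs_Seq)
      show "runs V gcd_load s (csz gcd_load) (\<lambda>s'. ?I l s' \<and> s' 9 = X ^ n \<and> s' 10 = X ^ Suc l)"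
        unfolding gcd_load_def
        by (rule wp_runs[OF bs]) (use I bounded_le[OF bs, of 5] bounded_le[OF bs, of 8] in simp)
      fix s2 assume s2: "bounded V s2" "?I l s2 \<and> s2 9 = X ^ n \<and> s2 10 = X ^ Suc l"
      show "runs V (Seq gcd_loop gcd_store) s2 (((n + Suc l) * gcd_unit + gcd_unit) + csz gcd_store + 1)
          (\<lambda>s'. s' 6 = l \<and> ?I (Suc l) (s'(6 := Suc l)))"
      proof (rule runs_Seq)
        show "runs V gcd_loop s2 ((n + Suc l) * gcd_unit + gcd_unit)
            (\<lambda>s'. s' 9 = X ^ gcd n (Suc l) \<and> (\<forall>r. r \<noteq> 9 \<and> r \<noteq> 10 \<longrightarrow> s' r = s2 r))"
          by (rule runs_gcd_loop[OF X1 s2(1)]) (use s2 l in auto)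
        fix s3 assume s3: "bounded V s3"
          "s3 9 = X ^ gcd n (Suc l) \<and> (\<forall>r. r \<noteq> 9 \<and> r \<noteq> 10 \<longrightarrow> s3 r = s2 r)"
        have I3: "?I l s3" using s2 s3 by simp
        have "(\<Sum>q=1..Suc l. X ^ gcd n q) \<le> of_nat (card {1..Suc l}) * X ^ n"
          by (rule sum_bounded_above) (use X1 l in \<open>auto intro!: power_increasing gcd_le1_nat\<close>)
        also have "\<dots> \<le> X * X ^ n"
        proof (rule mult_right_mono)
          have "Suc l \<le> 2 ^ n" using Suc_leI[OF l] less_imp_le[OF less_exp[of n]] by (rule order.trans)
          also have "(2 :: nat) ^ n \<le> X" unfolding X by (rule power_mono) auto
          finally show "of_nat (card {1..Suc l}) \<le> X" by simp
        qed simp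
        also have "\<dots> < 2 ^ V" using power_bound[of "n + 1"] by simp
        finally have b1: "(\<Sum>q=1..Suc l. X ^ gcd n q) < 2 ^ V" .
        have b2: "X ^ Suc (Suc l) < 2 ^ V" using l by (intro power_bound) auto
        have e1: "s3 7 + s3 9 = (\<Sum>q=1..Suc l. X ^ gcd n q)" using I3 s3 by simp
        have e2: "s3 8 * s3 4 < 2 ^ V" using b2 I3 by (simp add: ac_simps)
        show "runs V gcd_store s3 (csz gcd_store) (\<lambda>s'. s' 6 = l \<and> ?I (Suc l) (s'(6 := Suc l)))"
          unfolding gcd_store_def
          by (rule wp_runs[OF s3(1)]) (use I3 b1 e1 e2 in simp)
      qed
    qed
    then show "runs V ?c s (gcd_cost n) (\<lambda>s'. s' 6 = l \<and> ?I (Suc l) (s'(6 := Suc l)))"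
    proof (rule runs_mono)
      have "(n + Suc l) * gcd_unit \<le> (2 * n) * gcd_unit" using l by (intro mult_right_mono) auto
      then show "csz gcd_load + (((n + Suc l) * gcd_unit + gcd_unit) + csz gcd_store + 1) + 1 \<le> gcd_cost n"
        unfolding gcd_cost_def distrib_right by simp
    qed
  qed
  then show "runs V (for_n ?c) s1 (n * (gcd_cost n + for_n_overhead) + for_n_overhead)
    (\<lambda>s. s 0 = n \<and> s 1 = j \<and> s 2 = 0 \<and> s 3 = 0 \<and> s 16 = 0 \<and> s 4 = X \<and> s 5 = X ^ n \<and> s 7 = gcd_sum n X)"
    by (rule runs_post) (simp add: gcd_sum_def)
qed

text \<open>The candidate is computed before the forced test, so its bound must hold for every next
  bit; the size of the weighted polynomial does not depend on \<open>w 0\<close> being a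
  prenecklace.\<close>

lemma search_inv_weight_bound:
  assumes inv: "search_inv X n j l p F E z c" and l: "l < n"
  shows "E + (l + 1) * X ^ (n - 1 - l) < 2 ^ V"
proof -
  have p: "p < 2 ^ l" using inv by (simp add: search_inv_def)
  have wl: "\<not> word p l" using word_ge[OF p, of l] by simp
  have X0: "0 < X" by (simp add: X)
  have "E + (l + 1) * X ^ (n - 1 - l) = weighted_poly X n (word p) (Suc l)"
    unfolding search_invD(2)[OF inv] weighted_poly_Suc_False[of "word p", OF wl] ..
  also have "\<dots> \<le> n * n * X ^ (n - 1)" by (rule weighted_poly_le) (use l X0 in auto)
  also have "\<dots> \<le> X * X ^ (n - 1)"
  proof (rule mult_right_mono)
    have "n * n \<le> 2 ^ n * 2 ^ n" using less_imp_le[OF less_exp[of n]] by (intro mult_le_mono)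
    also have "\<dots> = (4 :: nat) ^ n" by (simp flip: power_mult_distrib)
    also have "\<dots> \<le> X" unfolding X by (rule power_mono) auto
    finally show "n * n \<le> X" .
  qed simp
  also have "\<dots> = X ^ n" using l by (simp flip: power_Suc)
  also have "\<dots> < 2 ^ V" by (rule power_bound) simp
  finally show ?thesis .
qed

lemma runs_count_candidate:
  assumes bs: "bounded V s" and st: "search_state n j X l s" and l: "l < n"
  shows "runs V count_candidate s (csz count_candidate)
    (\<lambda>s'. (\<forall>r. r \<noteq> 16 \<and> r \<noteq> 17 \<and> r \<noteq> 18 \<longrightarrow> s' r = s r) \<and>
      s' 17 = s 11 - X ^ (n - 1 - l) \<and> s' 18 = s 12 + (l + 1) * X ^ (n - 1 - l) \<and>
      (\<not> forced (s 3) (s 14) \<longrightarrow> s' 16 = card (gt_necklaces n (Suc l) (word (s 3)))))"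
proof -
  have inv: "search_inv X n j l (s 3) (s 11) (s 12) (s 14) (s 16)"
    and r: "s 0 = n" "s 4 = X" "s 5 = X ^ n" "s 6 = l" "s 7 = gcd_sum n X" "s 13 = X ^ (n - 1 - l)"
    using st l by (auto simp: search_state_def)
  define D E C where "D = s 11 - s 13" and "E = s 12 + (s 6 + 1) * s 13"
    and "C = s 5 * s 5 div D * (E * s 7) div (s 5 * s 5) mod s 4 div s 0"
  have D: "s 11 - s 13 = D" and E: "s 12 + (s 13 + s 6 * s 13) = E"
    and C: "s 5 * s 5 div D * (E * s 7) div (s 5 * s 5) mod s 4 div s 0 = C"
    by (simp_all add: D_def E_def C_def)
  have "D < 2 ^ V" unfolding D_def using bounded_le[OF bs, of 11] by simp
  moreover have "E < 2 ^ V" unfolding E_def r by (rule search_inv_weight_bound[OF inv l])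
  moreover have "C < 2 ^ V"
  proof -
    \<comment> \<open>For a forced bit \<open>C\<close> need not be a count, but the reduction
      modulo \<open>X\<close> bounds it all the same.\<close>
    have "C \<le> s 5 * s 5 div D * (E * s 7) div (s 5 * s 5) mod X"
      unfolding C_def r(2) by (rule div_le_dividend)
    also have "\<dots> < X" by (rule mod_less_divisor) (simp add: X)
    also have "X < 2 ^ V" using power_bound[of 1] by simp
    finally show ?thesis .
  qed
  moreover have "C = card (gt_necklaces n (Suc l) (word (s 3)))" if "\<not> forced (s 3) (s 14)"
    using search_inv_count[OF inv l X that] unfolding C_def D_def E_def r gcd_sum_def .
  moreover have "s 11 - X ^ (n - 1 - l) = D" "s 12 + (l + 1) * X ^ (n - 1 - l) = E"
    unfolding D_def E_def r by auto
  ultimately show ?thesis unfolding count_candidate_def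
    by (intro wp_runs[OF bs]) (simp add: D E C)
qed

lemma runs_choose_bit:
  assumes bs: "bounded V s" and inv: "search_inv X n j l (s 3) F E (s 14) c" and l: "l < n"
    and r: "s 1 = j" "s 15 = 2 ^ l" "s 11 = F" "s 12 = E"
      "s 17 = F - X ^ (n - 1 - l)" "s 18 = E + (l + 1) * X ^ (n - 1 - l)"
    and c: "\<not> forced (s 3) (s 14) \<Longrightarrow> s 16 = card (gt_necklaces n (Suc l) (word (s 3)))"
  shows "runs V choose_bit s (csz choose_bit)
    (\<lambda>s'. search_inv X n j (Suc l) (s' 3) (s' 11) (s' 12) (s' 14) (s' 16) \<and>
      (\<forall>r. r \<noteq> 3 \<and> r \<noteq> 11 \<and> r \<noteq> 12 \<and> r \<noteq> 14 \<longrightarrow> s' r = s r))"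
proof (rule wp_runs[OF bs])
  have "s 3 < 2 ^ l" using inv by (simp add: search_inv_def)
  then have "s 3 + s 15 < 2 ^ Suc l" using r by simp
  then have b3: "s 3 + s 15 < 2 ^ V" using small_bound[of "Suc l"] l by simp
  obtain k where k: "s 14 = 2 ^ (l + 1 - k)" using inv unfolding search_inv_def by blast
  have "s 14 * 2 = 2 ^ Suc (l + 1 - k)" unfolding k by simp
  also have "\<dots> < 2 ^ V" by (rule small_bound) (use l in simp)
  finally have b14: "s 14 * 2 < 2 ^ V" .
  have two: "2 < (2 :: nat) ^ V" using small_bound[of 2] by simp
  have b: "s 17 < 2 ^ V" "s 18 < 2 ^ V" using bs by (auto simp: bounded_def)
  show "wp V choose_bit (\<lambda>s'. search_inv X n j (Suc l) (s' 3) (s' 11) (s' 12) (s' 14) (s' 16) \<and>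
      (\<forall>r. r \<noteq> 3 \<and> r \<noteq> 11 \<and> r \<noteq> 12 \<and> r \<noteq> 14 \<longrightarrow> s' r = s r)) s"
  proof (cases "forced (s 3) (s 14)")
    case True
    have "search_inv X n j (Suc l) (s 3 + s 15) (s 11) (s 12) (s 14 * 2) (s 16)"
      unfolding r using search_inv_forced[OF inv l True] .
    then show ?thesis using True[unfolded forced_def] b3 b14 unfolding choose_bit_def by simp
  next
    case False
    show ?thesis
    proof (cases "s 16 < s 1")
      case lt: True
      have "search_inv X n j (Suc l) (s 3) (s 17) (s 18) (s 14 * 2) (s 16)"
        unfolding r by (rule search_inv_zero[OF inv l False c[OF False]]) (use lt r in simp)
      then show ?thesis using False[unfolded forced_def] lt b b14 unfolding choose_bit_def by simp
    next
      case ge: False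
      have "search_inv X n j (Suc l) (s 3 + s 15) (s 11) (s 12) 2 (s 16)"
        unfolding r by (rule search_inv_one[OF inv l False c[OF False]]) (use ge r in simp)
      then show ?thesis using False[unfolded forced_def] ge b3 two unfolding choose_bit_def by simp
    qed
  qed
qed

lemma runs_search_body:
  assumes bs: "bounded V s" and st: "search_state n j X l s" and l: "l < n"
  shows "runs V search_body s (csz search_body) (\<lambda>s'. s' 6 = l \<and> search_state n j X (Suc l) (s'(6 := Suc l)))"
  unfolding search_body_def csz.simps
proof (rule runs_Seq[OF runs_count_candidate[OF bs st l]], elim conjE)
  fix s1
  assume b1: "bounded V s1" and fr1: "\<forall>r. r \<noteq> 16 \<and> r \<noteq> 17 \<and> r \<noteq> 18 \<longrightarrow> s1 r = s r"
    and c17: "s1 17 = s 11 - X ^ (n - 1 - l)" and c18: "s1 18 = s 12 + (l + 1) * X ^ (n - 1 - l)"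
    and c16: "\<not> forced (s 3) (s 14) \<longrightarrow> s1 16 = card (gt_necklaces n (Suc l) (word (s 3)))"
  have inv: "search_inv X n j l (s1 3) (s 11) (s 12) (s1 14) (s 16)" using st fr1 by (simp add: search_state_def)
  have ch: "runs V choose_bit s1 (csz choose_bit)
    (\<lambda>s'. search_inv X n j (Suc l) (s' 3) (s' 11) (s' 12) (s' 14) (s' 16) \<and>
      (\<forall>r. r \<noteq> 3 \<and> r \<noteq> 11 \<and> r \<noteq> 12 \<and> r \<noteq> 14 \<longrightarrow> s' r = s1 r))"
    by (rule runs_choose_bit[OF b1 inv l])
      (use st fr1 c17 c18 c16 in \<open>simp_all add: search_state_def\<close>)
  show "runs V (Seq choose_bit advance) s1 (csz choose_bit + csz advance + 1)
    (\<lambda>s'. s' 6 = l \<and> search_state n j X (Suc l) (s'(6 := Suc l)))"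
  proof (rule runs_Seq[OF ch], elim conjE)
    fix s2
    assume b2: "bounded V s2" and inv2: "search_inv X n j (Suc l) (s2 3) (s2 11) (s2 12) (s2 14) (s2 16)"
      and fr2: "\<forall>r. r \<noteq> 3 \<and> r \<noteq> 11 \<and> r \<noteq> 12 \<and> r \<noteq> 14 \<longrightarrow> s2 r = s1 r"
    have r: "s2 0 = n" "s2 1 = j" "s2 2 = 0" "s2 4 = X" "s2 5 = X ^ n" "s2 6 = l" "s2 7 = gcd_sum n X"
      "s2 15 = 2 ^ l" "s2 13 = X ^ (n - 1 - l)"
      using st fr1 fr2 l by (simp_all add: search_state_def)
    have d: "s2 13 div s2 4 = X ^ (n - 1 - Suc l)" if "Suc l < n"
    proof -
      have "n - 1 - l = Suc (n - 1 - Suc l)" using that by simp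
      then show ?thesis unfolding r by (simp add: X)
    qed
    have db: "s2 13 div s2 4 < 2 ^ V"
      by (rule order.strict_trans1[OF div_le_dividend]) (rule bounded_le[OF b2])
    have e: "s2 15 * 2 = 2 ^ Suc l" unfolding r by simp
    have eb: "(2 :: nat) ^ Suc l < 2 ^ V" by (rule small_bound) (use l in simp)
    have "wp V advance (\<lambda>s'. s' 6 = l \<and> search_state n j X (Suc l) (s'(6 := Suc l))) s2"
      unfolding advance_def search_state_def
      by (simp del: power_Suc add: db e eb) (use r d inv2 in simp)
    then show "runs V advance s2 (csz advance) (\<lambda>s'. s' 6 = l \<and> search_state n j X (Suc l) (s'(6 := Suc l)))"
      by (rule wp_runs[OF b2])
  qed
qed

lemma runs_search_init:
  assumes bs: "bounded V s" and j: "1 \<le> j"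
    and r: "s 0 = n" "s 1 = j" "s 2 = 0" "s 3 = 0" "s 16 = 0" "s 4 = X" "s 5 = X ^ n" "s 7 = gcd_sum n X"
  shows "runs V search_init s (csz search_init) (\<lambda>s'. s' 0 = n \<and> search_state n j X 0 (s'(6 := 0)))"
proof (rule wp_runs[OF bs])
  have d: "s 5 div s 4 = X ^ (n - 1)" if "0 < n"
    unfolding r using that by (cases n) (simp_all add: X)
  have b: "s 5 div s 4 < 2 ^ V" "s 5 < 2 ^ V"
    using order.strict_trans1[OF div_le_dividend bounded_le[OF bs, of 5]] bounded_le[OF bs, of 5] by auto
  have one: "1 < (2 :: nat) ^ V" using small_bound[of 0] by simp
  show "wp V search_init (\<lambda>s'. s' 0 = n \<and> search_state n j X 0 (s'(6 := 0))) s"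
    unfolding search_init_def search_state_def
    using d b one r search_inv_0[OF j, of X n] by simp
qed

lemma runs_unrank:
  assumes j: "1 \<le> j"
  shows "runs V unrank (init_state n j) (unrank_cost n)
    (\<lambda>s. if j \<le> card (necklaces n) then s 2 = 0 \<and> selects n j (word (s 3)) else s 2 = 1)"
proof -
  have i: "bounded V (init_state n j)"
    unfolding bounded_def init_state_def using index_bound[of n] j_bound by simp
  show ?thesis unfolding unrank_def unrank_cost_def
  proof (rule runs_Seq[OF runs_power_pass[OF i]])
    fix s1
    assume b1: "bounded V s1" and s1: "s1 0 = n \<and> s1 1 = j \<and> s1 2 = 0 \<and> s1 3 = 0 \<and> s1 16 = 0 \<and> s1 4 = X"
    show "runs V (Seq power_pass2 (Seq gcd_pass (Seq search_init (Seq (for_n search_body) check_index)))) s1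
      ((csz (Assign 5 (Num 1)) + (n * (csz (Assign 5 (Mult (Var 5) (Var 4))) + for_n_overhead) + for_n_overhead) + 1) +
      ((csz (Seq (Assign 8 (Var 4)) (Assign 7 (Num 0))) + (n * (gcd_cost n + for_n_overhead) + for_n_overhead) + 1) +
      (csz search_init + ((n * (csz search_body + for_n_overhead) + for_n_overhead) + csz check_index + 1) + 1) + 1) + 1)
      (\<lambda>s. if j \<le> card (necklaces n) then s 2 = 0 \<and> selects n j (word (s 3)) else s 2 = 1)"
    proof (rule runs_Seq[OF runs_power_pass2[OF b1]])
      fix s2
      assume b2: "bounded V s2"
        and s2: "s2 0 = n \<and> s2 1 = j \<and> s2 2 = 0 \<and> s2 3 = 0 \<and> s2 16 = 0 \<and> s2 4 = X \<and> s2 5 = X ^ n"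
      show "runs V (Seq gcd_pass (Seq search_init (Seq (for_n search_body) check_index))) s2
        ((csz (Seq (Assign 8 (Var 4)) (Assign 7 (Num 0))) + (n * (gcd_cost n + for_n_overhead) + for_n_overhead) + 1) +
        (csz search_init + ((n * (csz search_body + for_n_overhead) + for_n_overhead) + csz check_index + 1) + 1) + 1)
        (\<lambda>s. if j \<le> card (necklaces n) then s 2 = 0 \<and> selects n j (word (s 3)) else s 2 = 1)"
      proof (rule runs_Seq[OF runs_gcd_pass[OF b2]])
        fix s3
        assume b3: "bounded V s3" and s3: "s3 0 = n \<and> s3 1 = j \<and> s3 2 = 0 \<and> s3 3 = 0 \<and> s3 16 = 0 \<and> s3 4 = X \<and>
          s3 5 = X ^ n \<and> s3 7 = gcd_sum n X"
        show "runs V (Seq search_init (Seq (for_n search_body) check_index)) s3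
          (csz search_init + ((n * (csz search_body + for_n_overhead) + for_n_overhead) + csz check_index + 1) + 1)
          (\<lambda>s. if j \<le> card (necklaces n) then s 2 = 0 \<and> selects n j (word (s 3)) else s 2 = 1)"
        proof (rule runs_Seq[OF runs_search_init[OF b3 j]])
          fix s4 assume b4: "bounded V s4" and s4: "s4 0 = n \<and> search_state n j X 0 (s4(6 := 0))"
          have loop: "runs V (for_n search_body) s4 (n * (csz search_body + for_n_overhead) + for_n_overhead)
              (search_state n j X n)"
            by (rule runs_for_n[OF index_bound[OF order.refl] b4])
              (use s4 runs_search_body in \<open>auto simp: search_state_def\<close>)
          show "runs V (Seq (for_n search_body) check_index) s4
            ((n * (csz search_body + for_n_overhead) + for_n_overhead) + csz check_index + 1)
            (\<lambda>s. if j \<le> card (necklaces n) then s 2 = 0 \<and> selects n j (word (s 3)) else s 2 = 1)"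
          proof (rule runs_Seq[OF loop])
            fix s5 assume b5: "bounded V s5" and s5: "search_state n j X n s5"
            have inv: "search_inv X n j n (s5 3) (s5 11) (s5 12) (s5 14) (s5 16)" and r: "s5 1 = j" "s5 2 = 0"
              using s5 by (simp_all add: search_state_def)
            have one: "1 < (2 :: nat) ^ V" using small_bound[of 0] by simp
            show "runs V check_index s5 (csz check_index)
              (\<lambda>s. if j \<le> card (necklaces n) then s 2 = 0 \<and> selects n j (word (s 3)) else s 2 = 1)"
              by (rule wp_runs[OF b5])
                (use search_inv_selects[OF inv] r one in \<open>auto simp: check_index_def split: if_splits\<close>)
          qed
        qed (use s3 in simp_all)
      qed (use s2 in simp_all)
    qed (use s1 in simp_all)
  qed (simp_all add: init_state_def)
qed

end

text \<open>The quadratic term comes from \<open>n\<close> runs of Euclid's algorithm with at most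
  \<open>2 * n\<close> steps each; the other passes are linear.\<close>

lemma unrank_cost_le: "\<exists>K. \<forall>n. unrank_cost n \<le> K * (n + 1) ^ 2"
proof -
  let ?h = for_n_overhead
  define k1 where "k1 = csz (Assign 4 (Num 1)) + csz (Assign 5 (Num 1)) + csz (Seq (Assign 8 (Var 4)) (Assign 7 (Num 0)))
    + csz search_init + csz check_index + 4 * ?h + 8"
  define k2 where "k2 = csz (Assign 4 (Mult (Var 4) (Num 64))) + csz (Assign 5 (Mult (Var 5) (Var 4))) +
    csz search_body + 4 * ?h + csz gcd_load + gcd_unit + csz gcd_store + 2"
  define k3 where "k3 = 2 * gcd_unit"
  have "unrank_cost n \<le> (k1 + k2 + k3) * (n + 1) ^ 2" for n
  proof -
    have "unrank_cost n \<le> k1 + k2 * n + k3 * (n * n)"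
      unfolding unrank_cost_def gcd_cost_def k1_def k2_def k3_def by (simp add: algebra_simps del: csz.simps)
    also have "\<dots> \<le> k1 * (n + 1) ^ 2 + k2 * (n + 1) ^ 2 + k3 * (n + 1) ^ 2"
    proof (intro add_mono mult_le_mono2)
      show "k1 \<le> k1 * (n + 1) ^ 2" by simp
    qed (simp_all add: power2_eq_square)
    finally show ?thesis by (simp add: distrib_right)
  qed
  then show ?thesis by blast
qed

theorem theorem4:
  shows "\<exists>(P :: com) (c :: nat) (d :: nat) (idx :: nat \<Rightarrow> nat \<Rightarrow> bool list set).
    (\<forall>n. bij_betw (idx n) {1..card (necklaces n)} (necklaces n)) \<and>
    (\<forall>n j. j \<ge> 1 \<longrightarrow>
       (\<exists>t s'. big_step P (init_state n j) t s' \<and>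
          t \<le> c * (n + bitlen j + 1) ^ d \<and>
          (if j \<le> card (necklaces n)
           then s' 2 = 0 \<and> decode_string n (s' 3) \<in> idx n j
           else s' 2 = 1)))"
proof -
  obtain K where K: "\<And>n. unrank_cost n \<le> K * (n + 1) ^ 2" using unrank_cost_le by blast
  have run: "\<exists>t s'. big_step unrank (init_state n j) t s' \<and> t \<le> (K * 9) * (n + bitlen j + 1) ^ 4 \<and>
      (if j \<le> card (necklaces n) then s' 2 = 0 \<and> selects n j (word (s' 3)) else s' 2 = 1)"
    if j: "1 \<le> j" for n j
  proof -
    define V where "V = 6 * n * n + 7 * n + 8 + bitlen j"
    let ?m = "n + bitlen j + 1"
    obtain t s' where t: "big_step unrank (init_state n j) t s'" "t \<le> unrank_cost n * Suc V"
      "if j \<le> card (necklaces n) then s' 2 = 0 \<and> selects n j (word (s' 3)) else s' 2 = 1"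
      using runs_unrank[OF refl V_def j] unfolding runs_def by blast
    have "unrank_cost n \<le> K * ?m ^ 2"
      by (rule order.trans[OF K]) (intro mult_le_mono2 power_mono, simp_all)
    \<comment> \<open>\<open>V\<close> is quadratic in \<open>n\<close>, so the exponent 4 splits
      into 2 for the number of units and 2 for the length of the registers.\<close>
    moreover have "Suc V \<le> 9 * ?m ^ 2" by (simp add: V_def power2_eq_square algebra_simps)
    ultimately have "t \<le> (K * ?m ^ 2) * (9 * ?m ^ 2)" using t(2) by (meson mult_le_mono order.trans)
    also have "\<dots> = (K * 9) * ?m ^ 4"
    proof -
      have "(K * x ^ 2) * (9 * x ^ 2) = (K * 9) * x ^ 4" for x :: nat
        by (simp add: power2_eq_square power4_eq_xxxx ac_simps)
      then show ?thesis .
    qed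
    finally show ?thesis using t by blast
  qed
  \<comment> \<open>A selecting word exists for each index up to the number of necklaces because the
    program, run on that index, leaves one in register 3.\<close>
  have "\<exists>idx. bij_betw idx {1..card (necklaces n)} (necklaces n) \<and>
      (\<forall>j w. selects n j w \<longrightarrow> map w [0..<n] \<in> idx j)" for n
  proof (rule selects_bij)
    fix j assume "j \<in> {1..card (necklaces n)}"
    then show "\<exists>w. selects n j w" using run[of j n] by auto
  qed
  then obtain idx where idx: "\<And>n. bij_betw (idx n) {1..card (necklaces n)} (necklaces n)"
    "\<And>n j w. selects n j w \<Longrightarrow> map w [0..<n] \<in> idx n j" by metis
  have "decode_string n p = map (word p) [0..<n]" for n p
    by (simp add: decode_string_def word_def)
  then have dec: "decode_string n p \<in> idx n j" if "selects n j (word p)" for n j p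
    using idx(2)[OF that] by simp
  show ?thesis
  proof (rule exI[of _ unrank], rule exI[of _ "K * 9"], rule exI[of _ 4], rule exI[of _ idx], intro conjI allI impI)
    show "bij_betw (idx n) {1..card (necklaces n)} (necklaces n)" for n by (rule idx(1))
    show "\<exists>t s'. big_step unrank (init_state n j) t s' \<and> t \<le> (K * 9) * (n + bitlen j + 1) ^ 4 \<and>
        (if j \<le> card (necklaces n) then s' 2 = 0 \<and> decode_string n (s' 3) \<in> idx n j else s' 2 = 1)"
      if "1 \<le> j" for n j
      using run[OF that, of n] dec by (metis (full_types))
  qed
qed

end
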